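(* Let $G_{\mathbb{C}}=Spin(7,\mathbb{C})$, $H_{\mathbb{C}}=G_2(\mathbb{C})$ and $G_u=Spin(7)$, with Lie algebras $\mathfrak{g},\mathfrak{h},\mathfrak{g}_u$, and let $\mathfrak{q}$ be the orthogonal complement of $\mathfrak{h}$ in $\mathfrak{g}$ with respect to the Killing form of $\mathfrak{g}$. Let $$\widetilde{\mathfrak{a}}_0=\{\operatorname{diag}(\delta_t,\delta_{-t/3},\delta_{-t/3},\delta_{-t/3}):t\in\mathbb{R}\},\qquad \delta_t=\begin{pmatrix}0&-\sqrt{-1}\,t\\\sqrt{-1}\,t&0\end{pmatrix}.$$ Then $\widetilde{\mathfrak{a}}_0\subset\sqrt{-1}\,\mathfrak{g}_u\cap\mathfrak{q}$, and the one-dimensional abelian group $\widetilde{A}_0=\exp\widetilde{\mathfrak{a}}_0$ satisfies $$G_{\mathbb{C}}=G_u\widetilde{A}_0H_{\mathbb{C}}.$$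
   Context: Cayley algebra: $\mathfrak{C}$ is the 8-dimensional real algebra with basis $e_0,\dots,e_7$, where $e_0$ is the unit, $e_i^2=-e_0$ for $i\ge 1$, $e_ie_j=-e_je_i$ for distinct $i,j\geq 1$, and $e_1e_2=e_3$, $e_1e_4=e_5$, $e_1e_6=e_7$, $e_2e_5=e_7$, $e_2e_6=e_4$, $e_3e_5=e_6$, $e_3e_4=e_7$ (each listed relation $e_ie_j=e_k$ also gives $e_je_k=e_i$ and $e_ke_i=e_j$). $\mathfrak{C}_{\mathbb{C}}=\mathfrak{C}\otimes_{\mathbb{R}}\mathbb{C}$ carries the complex symmetric bilinear form with $(e_i,e_j)=\delta_{ij}$. $SO(8,\mathbb{C})=\{g\in SL(8,\mathbb{C}):{}^tgg=I_8\}$ acts on $\mathfrak{C}_{\mathbb{C}}$ via the ordered basis $e_0,\dots,e_7$; $SO(7,\mathbb{C})=\{g\in SO(8,\mathbb{C}):ge_0=e_0\}$; $SO(8)$ and $SO(7)$ are the respective subgroups of real matrices. $G_2(\mathbb{C})=\{g\in SO(8,\mathbb{C}):(gx)(gy)=g(xy)\ \forall x,y\in\mathfrak{C}_{\mathbb{C}}\}$. $Spin(7,\mathbb{C})=\{g\in SO(8,\mathbb{C}):\exists g_0\in SO(7,\mathbb{C})\text{ with }(g_0x)(gy)=g(xy)\ \forall x,y\in\mathfrak{C}_{\mathbb{C}}\}$, and $Spin(7)=\{g\in SO(8):\exists g_0\in SO(7)\text{ with }(g_0x)(gy)=g(xy)\ \forall x,y\in\mathfrak{C}\}$, the fixed point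 group of the Cartan involution $g\mapsto\overline{g}$ of $Spin(7,\mathbb{C})$. One has $G_2(\mathbb{C})=\{g\in Spin(7,\mathbb{C}):ge_0=e_0\}$. Here $\operatorname{diag}$ denotes a block-diagonal matrix. *)

theory Defs
  imports "HOL-Analysis.Analysis" "HOL-Algebra.Group"
begin

section \<open>The Cayley algebra\<close>

text \<open>
  The complexified Cayley algebra is \<^typ>\<open>complex^8\<close>; the coordinate with index \<open>i :: 8\<close>
  (\<open>i = 0, \<dots>, 7\<close>) is the coefficient of \<open>e\<^sub>i\<close>.  A triple \<open>(i, j, k)\<close> below stands for
  \<open>e\<^sub>i e\<^sub>j = e\<^sub>k\<close>.
\<close>

definition cayley_triples :: "(8 \<times> 8 \<times> 8) set" where
  "cayley_triples =
     {(1, 2, 3), (1, 4, 5), (1, 6, 7), (2, 5, 7), (2, 6, 4), (3, 5, 6), (3, 4, 7)}"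

definition cayley_cyclic :: "(8 \<times> 8 \<times> 8) set" where
  "cayley_cyclic = (\<Union>(i, j, k) \<in> cayley_triples. {(i, j, k), (j, k, i), (k, i, j)})"

text \<open>\<open>cayley_coeff i j k\<close> is the coefficient of \<open>e\<^sub>k\<close> in \<open>e\<^sub>i e\<^sub>j\<close>.\<close>

definition cayley_coeff :: "8 \<Rightarrow> 8 \<Rightarrow> 8 \<Rightarrow> complex" where
  "cayley_coeff i j k =
     (if i = 0 then of_bool (k = j)
      else if j = 0 then of_bool (k = i)
      else if i = j then - of_bool (k = 0)
      else of_bool ((i, j, k) \<in> cayley_cyclic) - of_bool ((j, i, k) \<in> cayley_cyclic))"

definition cayley_mult :: "complex^8 \<Rightarrow> complex^8 \<Rightarrow> complex^8"  (infixl \<open>\<star>\<close> 70) where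
  "x \<star> y = (\<chi> k. \<Sum>i\<in>UNIV. \<Sum>j\<in>UNIV. cayley_coeff i j k * (x $ i) * (y $ j))"

text \<open>The real Cayley algebra, as the subset of real vectors.\<close>

definition cayley_real :: "(complex^8) set" where
  "cayley_real = {x. \<forall>i. x $ i \<in> \<real>}"

abbreviation cayley_unit :: "8 \<Rightarrow> complex^8"  (\<open>\<e>\<close>) where
  "\<e> i \<equiv> axis i 1"

lemma cayley_mult_basis: "\<e> i \<star> \<e> j = (\<chi> k. cayley_coeff i j k)"
proof -
  have "(\<Sum>a\<in>UNIV. \<Sum>b\<in>UNIV. cayley_coeff a b k * (\<e> i $ a) * (\<e> j $ b)) =
        cayley_coeff i j k" for k
  proof -
    have "(\<Sum>a\<in>UNIV. \<Sum>b\<in>UNIV. cayley_coeff a b k * (\<e> i $ a) * (\<e> j $ b)) =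
          (\<Sum>a\<in>UNIV. \<Sum>b\<in>UNIV. if b = j then (if a = i then cayley_coeff a b k else 0) else 0)"
      by (intro sum.cong refl) (auto simp: axis_def)
    then show ?thesis
      by simp
  qed
  then show ?thesis
    by (simp add: cayley_mult_def vec_eq_iff)
qed

text \<open>The multiplication table by which the Cayley algebra is usually given.\<close>

lemma cayley_table:
  "\<e> 0 \<star> \<e> i = \<e> i" "\<e> i \<star> \<e> 0 = \<e> i"
  "i \<noteq> 0 \<Longrightarrow> \<e> i \<star> \<e> i = - \<e> 0"
  "i \<noteq> 0 \<Longrightarrow> j \<noteq> 0 \<Longrightarrow> i \<noteq> j \<Longrightarrow> \<e> i \<star> \<e> j = - (\<e> j \<star> \<e> i)"
  unfolding cayley_mult_basis by (auto simp: cayley_coeff_def vec_eq_iff axis_def)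

lemma cayley_cyclic_unique:
  assumes "(i, j, k) \<in> cayley_cyclic"
  shows "i \<noteq> 0 \<and> j \<noteq> 0 \<and> i \<noteq> j \<and> (\<forall>l. (i, j, l) \<in> cayley_cyclic \<longleftrightarrow> l = k) \<and>
         (\<forall>l. (j, i, l) \<notin> cayley_cyclic)"
proof -
  have eq: "cayley_cyclic =
     {(3, 4, 7), (4, 7, 3), (7, 3, 4), (3, 5, 6), (5, 6, 3), (6, 3, 5), (2, 6, 4), (6, 4, 2),
      (4, 2, 6), (2, 5, 7), (5, 7, 2), (7, 2, 5), (1, 6, 7), (6, 7, 1), (7, 1, 6), (1, 4, 5),
      (4, 5, 1), (5, 1, 4), (1, 2, 3), (2, 3, 1), (3, 1, 2)}"
    unfolding cayley_cyclic_def cayley_triples_def by simp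
  from assms show ?thesis
    unfolding eq by (elim insertE emptyE) simp_all
qed

lemma cayley_table_triples:
  assumes "(i, j, k) \<in> cayley_triples"
  shows "\<e> i \<star> \<e> j = \<e> k" "\<e> j \<star> \<e> k = \<e> i" "\<e> k \<star> \<e> i = \<e> j"
proof -
  have *: "\<e> a \<star> \<e> b = \<e> c" if "(a, b, c) \<in> cayley_cyclic" for a b c
    unfolding cayley_mult_basis using cayley_cyclic_unique[OF that]
    by (auto simp: cayley_coeff_def vec_eq_iff axis_def)
  have "(i, j, k) \<in> cayley_cyclic" "(j, k, i) \<in> cayley_cyclic" "(k, i, j) \<in> cayley_cyclic"
    using assms unfolding cayley_cyclic_def by blast+
  then show "\<e> i \<star> \<e> j = \<e> k" "\<e> j \<star> \<e> k = \<e> i" "\<e> k \<star> \<e> i = \<e> j"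
    by (simp_all add: *)
qed

section \<open>The groups\<close>

definition SO8C :: "(complex^8^8) set" where
  "SO8C = {g. det g = 1 \<and> transpose g ** g = mat 1}"

definition SO7C :: "(complex^8^8) set" where
  "SO7C = {g \<in> SO8C. g *v \<e> 0 = \<e> 0}"

definition SO8 :: "(complex^8^8) set" where
  "SO8 = {g \<in> SO8C. \<forall>i j. g $ i $ j \<in> \<real>}"

definition SO7 :: "(complex^8^8) set" where
  "SO7 = {g \<in> SO7C. \<forall>i j. g $ i $ j \<in> \<real>}"

definition G2C :: "(complex^8^8) set" where
  "G2C = {g \<in> SO8C. \<forall>x y. (g *v x) \<star> (g *v y) = g *v (x \<star> y)}"

definition Spin7C :: "(complex^8^8) set" where
  "Spin7C = {g \<in> SO8C. \<exists>g0 \<in> SO7C. \<forall>x y. (g0 *v x) \<star> (g *v y) = g *v (x \<star> y)}"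

definition Spin7 :: "(complex^8^8) set" where
  "Spin7 = {g \<in> SO8. \<exists>g0 \<in> SO7. \<forall>x \<in> cayley_real. \<forall>y \<in> cayley_real.
              (g0 *v x) \<star> (g *v y) = g *v (x \<star> y)}"

section \<open>Lie algebras of matrix groups and the Killing form\<close>

text \<open>
  The product \<open>*\<close> of the type \<^typ>\<open>complex^'n^'n\<close> is entrywise, so the library's \<open>exp\<close> is not the
  matrix exponential.
\<close>

definition mexp :: "complex^'n^'n \<Rightarrow> complex^'n^'n" where
  "mexp A = (\<Sum>k. (1 / fact k) *\<^sub>R (((**) A ^^ k) (mat 1)))"

text \<open>
  For a complex closed matrix group this real definition yields a complex subspace, which is the
  complex Lie algebra of the group.
\<close>

definition lie_algebra :: "(complex^'n^'n) set \<Rightarrow> (complex^'n^'n) set" where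
  "lie_algebra G = {X. \<forall>t::real. mexp (t *\<^sub>R X) \<in> G}"

definition cscale :: "complex \<Rightarrow> complex^'n^'n \<Rightarrow> complex^'n^'n"  (infixr \<open>*\<^sub>C\<close> 75) where
  "c *\<^sub>C A = (\<chi> i j. c * A $ i $ j)"

interpretation cmat: vector_space "cscale :: complex \<Rightarrow> complex^'n^'n \<Rightarrow> complex^'n^'n"
  by unfold_locales (simp_all add: cscale_def vec_eq_iff algebra_simps)

text \<open>
  Trace of a complex linear endomorphism \<open>f\<close> of the complex subspace \<open>V\<close>, computed in a basis
  of \<open>V\<close>; it does not depend on the basis.
\<close>

definition trace_on :: "(complex^'n^'n) set \<Rightarrow> (complex^'n^'n \<Rightarrow> complex^'n^'n) \<Rightarrow> complex" where
  "trace_on V f =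
     (let B = (SOME B. cmat.independent B \<and> cmat.span B = V)
      in \<Sum>b\<in>B. cmat.representation B (f b) b)"

definition lie_bracket :: "complex^'n^'n \<Rightarrow> complex^'n^'n \<Rightarrow> complex^'n^'n" where
  "lie_bracket X Y = X ** Y - Y ** X"

definition killing_form ::
    "(complex^'n^'n) set \<Rightarrow> complex^'n^'n \<Rightarrow> complex^'n^'n \<Rightarrow> complex" where
  "killing_form L X Y = trace_on L (\<lambda>Z. lie_bracket X (lie_bracket Y Z))"

definition killing_orthogonal ::
    "(complex^'n^'n) set \<Rightarrow> (complex^'n^'n) set \<Rightarrow> (complex^'n^'n) set" where
  "killing_orthogonal L M = {X \<in> L. \<forall>Y \<in> M. killing_form L X Y = 0}"

section \<open>The abelian subspace\<close>

definition delta_mat :: "real \<Rightarrow> complex^2^2" where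
  "delta_mat t = vector [vector [0, - \<i> * of_real t], vector [\<i> * of_real t, 0]]"

text \<open>
  \<open>block_pos i\<close> is the position of the row or column \<open>i\<close> inside its \<open>2 \<times> 2\<close> block; rows and columns
  of \<^typ>\<open>complex^8^8\<close> are numbered from 0, those of \<^typ>\<open>complex^2^2\<close> from 1.
\<close>

definition block_pos :: "8 \<Rightarrow> 2" where
  "block_pos i = (if i \<in> {0, 2, 4, 6} then 1 else 2)"

definition block_diag ::
    "complex^2^2 \<Rightarrow> complex^2^2 \<Rightarrow> complex^2^2 \<Rightarrow> complex^2^2 \<Rightarrow> complex^8^8" where
  "block_diag A B C D = (\<chi> i j.
     if i \<in> {0, 1} \<and> j \<in> {0, 1} then A $ block_pos i $ block_pos j
     else if i \<in> {2, 3} \<and> j \<in> {2, 3} then B $ block_pos i $ block_pos j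
     else if i \<in> {4, 5} \<and> j \<in> {4, 5} then C $ block_pos i $ block_pos j
     else if i \<in> {6, 7} \<and> j \<in> {6, 7} then D $ block_pos i $ block_pos j
     else 0)"

definition a0_tilde :: "(complex^8^8) set" where
  "a0_tilde =
     {block_diag (delta_mat t) (delta_mat (- t / 3)) (delta_mat (- t / 3)) (delta_mat (- t / 3))
       | t. True}"

definition A0_tilde :: "(complex^8^8) set" where
  "A0_tilde = mexp ` a0_tilde"

definition matrix_group :: "(complex^'n^'n) set \<Rightarrow> (complex^'n^'n) monoid" where
  "matrix_group G = \<lparr>carrier = G, mult = (**), one = mat 1\<rparr>"

end

theory Submission
  imports Defs
begin

text \<open>
  A vector \<open>g e\<^sub>0\<close> with \<open>g \<in> Spin(7,\<complex>)\<close> has the form \<open>a + \<i> b\<close> with \<open>a\<close>, \<open>b\<close> real, orthogonal and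
  \<open>\<bar>a\<bar>\<^sup>2 - \<bar>b\<bar>\<^sup>2 = 1\<close>. The element of \<open>A\<^sub>0\<close> with parameter \<open>t\<close> maps \<open>e\<^sub>0\<close> to
  \<open>cosh t e\<^sub>0 + \<i> sinh t e\<^sub>1\<close>, and \<open>Spin(7)\<close>, which contains the left multiplications by imaginary units,
  is transitive on orthonormal pairs; so \<open>g e\<^sub>0 = k s e\<^sub>0\<close> with \<open>k \<in> Spin(7)\<close> and \<open>s \<in> A\<^sub>0\<close>, and
  \<open>(k s)\<^sup>-\<^sup>1 g\<close> fixes \<open>e\<^sub>0\<close>, hence lies in \<open>G\<^sub>2(\<complex>)\<close>. For the orthogonality, the Killing form is
  invariant under conjugation by the elements of \<open>G\<^sub>2(\<complex>)\<close> commuting with \<open>a\<^sub>0\<close>, and the average of any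
  derivation over a suitable finite group of these vanishes.
\<close>

subsection \<open>The matrix exponential\<close>

text \<open>The Killing form is a trace over an unspecified basis, so evaluating it directly would
  require an explicit basis of the Lie algebra of Spin(7,C) with its brackets. Orthogonality is
  deduced instead from two properties of a trace: additivity and tr(fg) = tr(gf). Lie algebras are
  given by one-parameter groups. The passage from group to algebra is differentiation at 0, the
  passage back is uniqueness of the solution of F' = A F. The covering element \<open>g0\<close> in
  the definition of \<open>Spin7C\<close> is only asserted to exist, so its dependence on t along a
  one-parameter group is unknown at first; evaluating the relation at the preimage of e0 expresses
  it through g and makes it differentiable. The ratio -1/3 in \<open>a0_tilde\<close> is what the
  infinitesimal triality relation demands. The orbit of e0 sees only the plane of e0 and e1, so that
  ratio has no influence on it.\<close>

lemma bounded_bilinear_matrix_mult: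
  "bounded_bilinear ((**) :: complex^'m^'n \<Rightarrow> complex^'k^'m \<Rightarrow> complex^'k^'n)"
  unfolding bilinear_conv_bounded_bilinear[symmetric] bilinear_def
  by (auto intro!: linearI simp: matrix_matrix_mult_def vec_eq_iff sum.distrib algebra_simps
      scaleR_sum_right)

lemma bounded_bilinear_matrix_vector_mult:
  "bounded_bilinear ((*v) :: complex^'m^'n \<Rightarrow> complex^'m \<Rightarrow> complex^'n)"
  unfolding bilinear_conv_bounded_bilinear[symmetric] bilinear_def
  by (auto intro!: linearI simp: matrix_vector_mult_def vec_eq_iff sum.distrib algebra_simps
      scaleR_sum_right)

lemma bounded_linear_transpose:
  "bounded_linear (transpose :: complex^'m^'n \<Rightarrow> complex^'n^'m)"
  unfolding linear_conv_bounded_linear[symmetric]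
  by (auto intro!: linearI simp: transpose_def vec_eq_iff)

lemmas matrix_mult_deriv =
  bounded_bilinear.has_vector_derivative[OF bounded_bilinear_matrix_mult]

lemma matrix_mult_minus [simp]:
  fixes A :: "complex^'m^'n" and B :: "complex^'k^'m"
  shows "(- A) ** B = - (A ** B)" "A ** (- B) = - (A ** B)"
  using bounded_bilinear.minus_left[OF bounded_bilinear_matrix_mult]
    bounded_bilinear.minus_right[OF bounded_bilinear_matrix_mult] by blast+

lemma matrix_vector_mult_minus [simp]:
  fixes A :: "complex^'m^'n"
  shows "(- A) *v x = - (A *v x)" "A *v (- x) = - (A *v x)"
  using bounded_bilinear.minus_left[OF bounded_bilinear_matrix_vector_mult]
    bounded_bilinear.minus_right[OF bounded_bilinear_matrix_vector_mult] by blast+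

lemma matrix_mult_zero [simp]:
  fixes A :: "complex^'m^'n" and B :: "complex^'k^'m"
  shows "0 ** B = (0 :: complex^'k^'n)" "A ** 0 = (0 :: complex^'k^'n)"
  by (simp_all add: matrix_matrix_mult_def vec_eq_iff)

lemma transpose_simps:
  fixes A B :: "complex^'m^'n"
  shows "transpose (- A) = - transpose A" "transpose (A + B) = transpose A + transpose B"
    "transpose (A - B) = transpose A - transpose B"
  by (simp_all add: transpose_def vec_eq_iff)

lemma matrix_mult_distrib:
  fixes A A' :: "complex^'m^'n" and B B' :: "complex^'k^'m"
  shows "(A + A') ** B = A ** B + A' ** B" "A ** (B + B') = A ** B + A ** B'"
    "(A - A') ** B = A ** B - A' ** B" "A ** (B - B') = A ** B - A ** B'"
  using bounded_bilinear.add_left[OF bounded_bilinear_matrix_mult]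
    bounded_bilinear.add_right[OF bounded_bilinear_matrix_mult]
    bounded_bilinear.diff_left[OF bounded_bilinear_matrix_mult]
    bounded_bilinear.diff_right[OF bounded_bilinear_matrix_mult] by blast+

lemma has_vector_derivative_vecI:
  fixes f :: "real \<Rightarrow> 'a::real_normed_vector^'n"
  assumes "\<And>i. ((\<lambda>t. f t $ i) has_vector_derivative f' $ i) (at t)"
  shows "(f has_vector_derivative f') (at t)"
proof -
  have "((\<lambda>y. ((f y - f t) - (y - t) *\<^sub>R f') /\<^sub>R norm (y - t)) \<longlongrightarrow> 0) (at t)"
    using assms
    by (intro vec_tendstoI) (simp add: has_vector_derivative_def has_derivative_def netlimit_at)
  then show ?thesis
    by (simp add: has_vector_derivative_def has_derivative_def netlimit_at bounded_linear_scaleR_left)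
qed

section \<open>Convergence and derivative of the exponential series\<close>

abbreviation matrix_power :: "complex^'n^'n \<Rightarrow> nat \<Rightarrow> complex^'n^'n" where
  "matrix_power A k \<equiv> ((**) A ^^ k) (mat 1)"

lemma matrix_power_commute: "matrix_power A k ** A = A ** matrix_power A k"
  by (induction k) (simp_all add: matrix_mul_assoc[symmetric])

lemma matrix_power_scaleR: "matrix_power (t *\<^sub>R A) k = t ^ k *\<^sub>R matrix_power A k"
proof (induction k)
  case (Suc k)
  have "matrix_power (t *\<^sub>R A) (Suc k) = (t *\<^sub>R A) ** (t ^ k *\<^sub>R matrix_power A k)"
    using Suc by simp
  also have "\<dots> = t *\<^sub>R (t ^ k *\<^sub>R (A ** matrix_power A k))"
    by (metis matrix_scalar_ac scalar_matrix_assoc)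
  finally show ?case by simp
qed simp

text \<open>Each row sum of norms is at most the sum \<open>c\<close> of the norms of all entries,
  so a multiplication by \<open>A\<close> costs one factor \<open>c\<close>.\<close>

lemma matrix_power_bound:
  fixes A :: "complex^'n^'n"
  defines "c \<equiv> \<Sum>i\<in>UNIV. \<Sum>l\<in>UNIV. norm (A $ i $ l)"
  shows "norm (matrix_power A k $ i $ j) \<le> c ^ k"
proof (induction k arbitrary: i)
  case 0
  show ?case by (simp add: mat_def)
next
  case (Suc k)
  have c0: "0 \<le> c" unfolding c_def by (intro sum_nonneg) auto
  have "norm (matrix_power A (Suc k) $ i $ j) \<le> (\<Sum>l\<in>UNIV. norm (A $ i $ l) * norm (matrix_power A k $ l $ j))"
    by (simp add: matrix_matrix_mult_def) (metis (no_types, lifting) norm_mult norm_sum sum.cong)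
  also have "\<dots> \<le> (\<Sum>l\<in>UNIV. norm (A $ i $ l) * c ^ k)"
    by (intro sum_mono mult_left_mono Suc) auto
  also have "\<dots> = (\<Sum>l\<in>UNIV. norm (A $ i $ l)) * c ^ k"
    by (simp add: sum_distrib_right)
  also have "\<dots> \<le> c * c ^ k"
    unfolding c_def[symmetric]
    by (intro mult_right_mono zero_le_power c0)
       (auto simp: c_def intro!: member_le_sum[where f = "\<lambda>i. \<Sum>l\<in>UNIV. norm (A $ i $ l)"] sum_nonneg)
  finally show ?case by simp
qed

text \<open>The variable is complex although only real times occur: termwise differentiation is done
  for the complex power series and then restricted to the real line.\<close>

lemma summable_matrix_exp:
  fixes A :: "complex^'n^'n" and z :: complex
  shows "summable (\<lambda>k. (matrix_power A k $ i $ j / fact k) * z ^ k)"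
proof (rule summable_comparison_test)
  define c where "c = (\<Sum>i\<in>UNIV. \<Sum>l\<in>UNIV. norm (A $ i $ l))"
  show "summable (\<lambda>k. inverse (fact k) * (c * norm z) ^ k)"
    by (rule summable_exp)
  show "\<exists>N. \<forall>k\<ge>N. norm ((matrix_power A k $ i $ j / fact k) * z ^ k) \<le> inverse (fact k) * (c * norm z) ^ k"
  proof (intro exI allI impI)
    fix k :: nat
    have "norm (matrix_power A k $ i $ j) * norm z ^ k / fact k \<le> c ^ k * norm z ^ k / fact k"
      unfolding c_def by (intro divide_right_mono mult_right_mono matrix_power_bound) auto
    then show "norm ((matrix_power A k $ i $ j / fact k) * z ^ k) \<le> inverse (fact k) * (c * norm z) ^ k"
      by (simp add: norm_mult norm_divide norm_power power_mult_distrib field_simps)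
  qed
qed

lemma mexp_sums_entry:
  fixes A :: "complex^'n^'n"
  shows "(\<lambda>k. (matrix_power A k $ i $ j / fact k) * of_real t ^ k) sums (mexp (t *\<^sub>R A) $ i $ j)"
proof -
  let ?f = "\<lambda>k. (1 / fact k) *\<^sub>R matrix_power (t *\<^sub>R A) k"
  let ?g = "\<lambda>i j k. (matrix_power A k $ i $ j / fact k) * of_real t ^ k"
  have e: "?f k $ i $ j = ?g i j k" for i j k
    by (simp add: matrix_power_scaleR del: of_real_power)
       (simp add: scaleR_conv_of_real field_simps)
  have "?f sums (\<chi> i j. suminf (?g i j))"
    unfolding sums_def
  proof (intro vec_tendstoI)
    fix i j
    show "(\<lambda>n. (\<Sum>k<n. ?f k) $ i $ j) \<longlonglongrightarrow> (\<chi> i j. suminf (?g i j)) $ i $ j"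
      using summable_sums[OF summable_matrix_exp[of A i j "of_real t"]]
      unfolding sum_component e by (simp add: sums_def)
  qed
  then have "mexp (t *\<^sub>R A) = (\<chi> i j. suminf (?g i j))"
    unfolding mexp_def by (rule sums_unique[symmetric])
  then show ?thesis
    using summable_sums[OF summable_matrix_exp[of A i j "of_real t"]] by simp
qed

lemma matrix_mult_entry: "(A ** B) $ i $ j = (\<Sum>l\<in>UNIV. A $ i $ l * B $ l $ j)"
  by (simp add: matrix_matrix_mult_def)

lemma mexp_zero [simp]: "mexp (0 :: complex^'n^'n) = mat 1"
proof -
  have "mexp (0 :: complex^'n^'n) $ i $ j = mat 1 $ i $ j" for i j
    using mexp_sums_entry[of 0 i j 0] powser_sums_zero[of "\<lambda>k. matrix_power (0::complex^'n^'n) k $ i $ j / fact k"]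
    by (auto dest: sums_unique2)
  then show ?thesis by (simp add: vec_eq_iff)
qed

lemma mexp_deriv:
  fixes A :: "complex^'n^'n"
  shows "((\<lambda>t. mexp (t *\<^sub>R A)) has_vector_derivative A ** mexp (t *\<^sub>R A)) (at t)"
proof (intro has_vector_derivative_vecI)
  fix i j
  let ?c = "\<lambda>i k. matrix_power A k $ i $ j / fact k"
  \<comment> \<open>Shifting the coefficients amounts to a left multiplication by \<open>A\<close>:
    \<open>diffs\<close> cancels one factor of the factorial and raises the power by one.\<close>
  have d: "diffs (?c i) = (\<lambda>k. \<Sum>l\<in>UNIV. A $ i $ l * ?c l k)"
  proof
    fix k
    have "diffs (?c i) k = matrix_power A (Suc k) $ i $ j / fact k"
      by (simp add: diffs_def field_simps del: of_nat_Suc)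
    then show "diffs (?c i) k = (\<Sum>l\<in>UNIV. A $ i $ l * ?c l k)"
      by (simp only: funpow.simps o_apply matrix_mult_entry sum_divide_distrib times_divide_eq_right)
  qed
  have "(\<Sum>k. diffs (?c i) k * of_real t ^ k) =
        (\<Sum>k. \<Sum>l\<in>UNIV. A $ i $ l * (?c l k * of_real t ^ k))"
    unfolding d by (simp add: sum_distrib_right mult.assoc)
  also have "\<dots> = (\<Sum>l\<in>UNIV. \<Sum>k. A $ i $ l * (?c l k * of_real t ^ k))"
    by (intro suminf_sum summable_mult summable_matrix_exp)
  also have "\<dots> = (\<Sum>l\<in>UNIV. A $ i $ l * mexp (t *\<^sub>R A) $ l $ j)"
    by (intro sum.cong refl sums_unique[symmetric] sums_mult mexp_sums_entry)
  finally have e: "(\<Sum>k. diffs (?c i) k * of_real t ^ k) = (A ** mexp (t *\<^sub>R A)) $ i $ j"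
    by (simp add: matrix_matrix_mult_def)
  have "((\<lambda>z. \<Sum>k. ?c i k * z ^ k) has_field_derivative (A ** mexp (t *\<^sub>R A)) $ i $ j) (at (of_real t))"
    unfolding e[symmetric]
    by (intro termdiffs_strong_converges_everywhere summable_matrix_exp)
  from has_vector_derivative_real_field[OF this, of UNIV]
  show "((\<lambda>t. mexp (t *\<^sub>R A) $ i $ j) has_vector_derivative (A ** mexp (t *\<^sub>R A)) $ i $ j) (at t)"
    using mexp_sums_entry[of A i j] by (simp add: sums_iff)
qed

lemma mexp_commute: 
  fixes A :: "complex^'n^'n"
  shows "mexp (t *\<^sub>R A) ** A = A ** mexp (t *\<^sub>R A)"
proof -
  have "(mexp (t *\<^sub>R A) ** A) $ i $ j = (A ** mexp (t *\<^sub>R A)) $ i $ j" for i j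
  proof (rule sums_unique2)
    let ?c = "\<lambda>i j k. (matrix_power A k $ i $ j / fact k) * of_real t ^ k"
    show "(\<lambda>k. \<Sum>l\<in>UNIV. ?c i l k * A $ l $ j) sums (mexp (t *\<^sub>R A) ** A) $ i $ j"
      unfolding matrix_mult_entry by (intro sums_sum sums_mult2 mexp_sums_entry)
    have "(\<Sum>l\<in>UNIV. ?c i l k * A $ l $ j) = (\<Sum>l\<in>UNIV. A $ i $ l * ?c l j k)" for k
    proof -
      have "(\<Sum>l\<in>UNIV. ?c i l k * A $ l $ j) = (matrix_power A k ** A) $ i $ j * (of_real t ^ k / fact k)"
        unfolding matrix_mult_entry sum_distrib_right by (intro sum.cong refl) simp
      also have "\<dots> = (\<Sum>l\<in>UNIV. A $ i $ l * ?c l j k)"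
        unfolding matrix_power_commute unfolding matrix_mult_entry sum_distrib_right
        by (intro sum.cong refl) simp
      finally show ?thesis .
    qed
    moreover have "(\<lambda>k. \<Sum>l\<in>UNIV. A $ i $ l * ?c l j k) sums (A ** mexp (t *\<^sub>R A)) $ i $ j"
      unfolding matrix_mult_entry by (intro sums_sum sums_mult mexp_sums_entry)
    ultimately show "(\<lambda>k. \<Sum>l\<in>UNIV. ?c i l k * A $ l $ j) sums (A ** mexp (t *\<^sub>R A)) $ i $ j"
      by simp
  qed
  then show ?thesis by (simp add: vec_eq_iff)
qed

lemma mexp_minus_deriv:
  fixes A :: "complex^'n^'n"
  shows "((\<lambda>t. mexp (- t *\<^sub>R A)) has_vector_derivative - (mexp (- t *\<^sub>R A) ** A)) (at t)"
  using mexp_deriv[of "- A" t] mexp_commute[of "- t" A] by simp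

text \<open>The product on the left has derivative zero. Through this, the inverse, addition,
  conjugation and transposition rules below come from comparing differential equations rather than
  from multiplying series.\<close>

lemma mexp_ode_aux:
  fixes A :: "complex^'n^'n" and F :: "real \<Rightarrow> complex^'m^'n"
  assumes "\<And>t. (F has_vector_derivative A ** F t) (at t)"
  shows "mexp (- t *\<^sub>R A) ** F t = F 0"
proof -
  have "((\<lambda>t. mexp (- t *\<^sub>R A) ** F t) has_vector_derivative 0) (at t within UNIV)" for t
    using matrix_mult_deriv[OF mexp_minus_deriv[of A t] assms[of t]]
    by (simp add: matrix_mul_assoc)
  then obtain c where "\<And>t. mexp (- t *\<^sub>R A) ** F t = c"
    using has_vector_derivative_zero_constant[of UNIV "\<lambda>t. mexp (- t *\<^sub>R A) ** F t"] by auto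
  from this[of t] this[of 0] show ?thesis by simp
qed

lemma mexp_inverse:
  fixes A :: "complex^'n^'n"
  shows "mexp (- t *\<^sub>R A) ** mexp (t *\<^sub>R A) = mat 1" "mexp (t *\<^sub>R A) ** mexp (- t *\<^sub>R A) = mat 1"
  using mexp_ode_aux[OF mexp_deriv, of t A] matrix_left_right_inverse by auto

lemma mexp_ode_unique:
  fixes A :: "complex^'n^'n" and F :: "real \<Rightarrow> complex^'m^'n"
  assumes "\<And>t. (F has_vector_derivative A ** F t) (at t)"
  shows "F t = mexp (t *\<^sub>R A) ** F 0"
  using mexp_ode_aux[of F A t, OF assms] mexp_inverse(2)[of t A]
  by (metis matrix_mul_assoc matrix_mul_lid)

lemma mexp_ode_vector_unique:
  fixes A :: "complex^'n^'n" and F :: "real \<Rightarrow> complex^'n"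
  assumes "\<And>t. (F has_vector_derivative A *v F t) (at t)"
  shows "F t = mexp (t *\<^sub>R A) *v F 0"
proof -
  have "((\<lambda>t. mexp (- t *\<^sub>R A) *v F t) has_vector_derivative 0) (at t within UNIV)" for t
    using bounded_bilinear.has_vector_derivative[OF bounded_bilinear_matrix_vector_mult
        mexp_minus_deriv[of A t] assms[of t]]
    by (simp add: matrix_vector_mul_assoc)
  then obtain c where "\<And>t. mexp (- t *\<^sub>R A) *v F t = c"
    using has_vector_derivative_zero_constant[of UNIV "\<lambda>t. mexp (- t *\<^sub>R A) *v F t"] by auto
  from this[of t] this[of 0] have "mexp (- t *\<^sub>R A) *v F t = F 0" by simp
  then show ?thesis
    by (metis matrix_vector_mul_assoc matrix_vector_mul_lid mexp_inverse(2))
qed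

lemma mexp_add:
  fixes A :: "complex^'n^'n"
  shows "mexp ((s + t) *\<^sub>R A) = mexp (s *\<^sub>R A) ** mexp (t *\<^sub>R A)"
proof -
  have "((\<lambda>s. mexp ((s + t) *\<^sub>R A)) has_vector_derivative A ** mexp ((s + t) *\<^sub>R A)) (at s)" for s
  proof -
    have "((\<lambda>s. s + t) has_vector_derivative 1) (at s)"
      by (auto intro!: derivative_eq_intros)
    from vector_diff_chain_at[OF this mexp_deriv[of A "s + t"]] show ?thesis
      by (simp add: o_def del: scaleR_left.add)
  qed
  from mexp_ode_unique[of "\<lambda>s. mexp ((s + t) *\<^sub>R A)", OF this] show ?thesis by simp
qed

lemma mexp_conj:
  fixes k l A :: "complex^'n^'n"
  assumes "l ** k = mat 1"
  shows "mexp (t *\<^sub>R (k ** A ** l)) = k ** mexp (t *\<^sub>R A) ** l"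
proof -
  have kl: "k ** l = mat 1" using assms matrix_left_right_inverse by blast
  have "((\<lambda>t. k ** mexp (t *\<^sub>R A) ** l) has_vector_derivative (k ** A ** l) ** (k ** mexp (t *\<^sub>R A) ** l)) (at t)" for t
  proof -
    have "((\<lambda>t. k ** mexp (t *\<^sub>R A) ** l) has_vector_derivative k ** (A ** mexp (t *\<^sub>R A)) ** l) (at t)"
      using matrix_mult_deriv[OF matrix_mult_deriv[OF has_vector_derivative_const mexp_deriv[of A t], of k] has_vector_derivative_const, of l]
      by simp
    moreover have "k ** (A ** mexp (t *\<^sub>R A)) ** l = (k ** A ** l) ** (k ** mexp (t *\<^sub>R A) ** l)"
      by (simp only: matrix_mul_assoc[symmetric]) (simp add: matrix_mul_assoc assms)
    ultimately show ?thesis by simp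
  qed
  from mexp_ode_unique[of "\<lambda>t. k ** mexp (t *\<^sub>R A) ** l", OF this, of t] show ?thesis
    by (simp add: kl)
qed

lemma transpose_mexp: "transpose (mexp (t *\<^sub>R A)) = mexp (t *\<^sub>R transpose A)"
  for A :: "complex^'n^'n"
proof -
  have "((\<lambda>t. transpose (mexp (t *\<^sub>R A))) has_vector_derivative transpose A ** transpose (mexp (t *\<^sub>R A))) (at t)" for t
    using bounded_linear.has_vector_derivative[OF bounded_linear_transpose mexp_deriv[of A t]]
    by (simp add: mexp_commute[symmetric] matrix_transpose_mul)
  from mexp_ode_unique[of "\<lambda>t. transpose (mexp (t *\<^sub>R A))", OF this] show ?thesis by simp
qed

lemma mexp_skew_orthogonal:
  fixes A :: "complex^'n^'n"
  assumes "transpose A = - A"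
  shows "transpose (mexp (t *\<^sub>R A)) ** mexp (t *\<^sub>R A) = mat 1" "det (mexp (t *\<^sub>R A)) = 1"
proof -
  show o: "transpose (mexp (t *\<^sub>R A)) ** mexp (t *\<^sub>R A) = mat 1" for t
    using mexp_inverse(1)[of t A] by (simp add: transpose_mexp assms)
  \<comment> \<open>Orthogonality leaves the sign of the determinant open; writing the exponential
    as a square settles it.\<close>
  have "det (mexp ((t/2) *\<^sub>R A)) * det (mexp ((t/2) *\<^sub>R A)) = 1"
    using arg_cong[OF o[of "t/2"], of det] by (simp add: det_mul det_transpose)
  then show "det (mexp (t *\<^sub>R A)) = 1"
    using mexp_add[of "t/2" "t/2" A] by (simp add: det_mul)
qed

lemma mexp_deriv_0: "((\<lambda>t. mexp (t *\<^sub>R A)) has_vector_derivative A) (at 0)"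
  for A :: "complex^'n^'n"
  using mexp_deriv[of A 0] by simp

lemma mexp_real_entries:
  assumes "\<And>i j. A $ i $ j \<in> \<real>"
  shows "mexp A $ i $ j \<in> \<real>"
proof -
  have r: "matrix_power A k $ i $ j \<in> \<real>" for k i j
  proof (induction k arbitrary: i)
    case (Suc k)
    then show ?case
      by (simp add: matrix_mult_entry) (intro sum_in_Reals Reals_mult assms)
  qed (simp add: mat_def)
  have lim: "(\<lambda>n. \<Sum>k<n. matrix_power A k $ i $ j / fact k) \<longlonglongrightarrow> mexp A $ i $ j"
    using mexp_sums_entry[of A i j 1] unfolding sums_def by (simp only: of_real_1 power_one mult_1_right scaleR_one)
  have real: "(\<Sum>k<n. matrix_power A k $ i $ j / fact k) \<in> \<real>" for n
  proof (intro sum_in_Reals Reals_divide r)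
    show "(fact k :: complex) \<in> \<real>" for k
      using Reals_of_nat[of "fact k"] by (simp only: of_nat_fact)
  qed
  show ?thesis
    by (rule Lim_in_closed_set[OF closed_complex_Reals _ sequentially_bot lim]) (rule always_eventually, rule allI, rule real)
qed

subsection \<open>Octonion identities\<close>

lemma UNIV_8: "(UNIV :: 8 set) = {0, 1, 2, 3, 4, 5, 6, 7}"
proof -
  have "card {0, 1, 2, 3, 4, 5, 6, 7 :: 8} = CARD(8)" by simp
  then show ?thesis by (intro card_subset_eq[symmetric]) auto
qed

lemma forall_8:
  "(\<forall>i::8. P i) \<longleftrightarrow> P 0 \<and> P 1 \<and> P 2 \<and> P 3 \<and> P 4 \<and> P 5 \<and> P 6 \<and> P 7"
  using UNIV_8 by (metis UNIV_I insertE emptyE)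

lemma sum_8: "sum f (UNIV :: 8 set) = f 0 + f 1 + f 2 + f 3 + f 4 + f 5 + f 6 + f 7"
  unfolding UNIV_8 by (simp add: add.assoc)

lemma vec_eq_8:
  "(x :: 'a^8) = y \<longleftrightarrow> x $ 0 = y $ 0 \<and> x $ 1 = y $ 1 \<and> x $ 2 = y $ 2 \<and> x $ 3 = y $ 3 \<and>
     x $ 4 = y $ 4 \<and> x $ 5 = y $ 5 \<and> x $ 6 = y $ 6 \<and> x $ 7 = y $ 7"
  by (simp add: vec_eq_iff forall_8)

lemma cayley_cyclic_eq: "cayley_cyclic =
     {(3, 4, 7), (4, 7, 3), (7, 3, 4), (3, 5, 6), (5, 6, 3), (6, 3, 5), (2, 6, 4), (6, 4, 2),
      (4, 2, 6), (2, 5, 7), (5, 7, 2), (7, 2, 5), (1, 6, 7), (6, 7, 1), (7, 1, 6), (1, 4, 5),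
      (4, 5, 1), (5, 1, 4), (1, 2, 3), (2, 3, 1), (3, 1, 2)}"
  unfolding cayley_cyclic_def cayley_triples_def by simp

lemma cayley_mult_nth:
  "(x \<star> y) $ 0 = x$0*y$0 - x$1*y$1 - x$2*y$2 - x$3*y$3 - x$4*y$4 - x$5*y$5 - x$6*y$6 - x$7*y$7"
  "(x \<star> y) $ 1 = x$0*y$1 + x$1*y$0 + x$2*y$3 - x$3*y$2 + x$4*y$5 - x$5*y$4 + x$6*y$7 - x$7*y$6"
  "(x \<star> y) $ 2 = x$0*y$2 - x$1*y$3 + x$2*y$0 + x$3*y$1 - x$4*y$6 + x$5*y$7 + x$6*y$4 - x$7*y$5"
  "(x \<star> y) $ 3 = x$0*y$3 + x$1*y$2 - x$2*y$1 + x$3*y$0 + x$4*y$7 + x$5*y$6 - x$6*y$5 - x$7*y$4"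
  "(x \<star> y) $ 4 = x$0*y$4 - x$1*y$5 + x$2*y$6 - x$3*y$7 + x$4*y$0 + x$5*y$1 - x$6*y$2 + x$7*y$3"
  "(x \<star> y) $ 5 = x$0*y$5 + x$1*y$4 - x$2*y$7 - x$3*y$6 - x$4*y$1 + x$5*y$0 + x$6*y$3 + x$7*y$2"
  "(x \<star> y) $ 6 = x$0*y$6 - x$1*y$7 - x$2*y$4 + x$3*y$5 + x$4*y$2 - x$5*y$3 + x$6*y$0 + x$7*y$1"
  "(x \<star> y) $ 7 = x$0*y$7 + x$1*y$6 + x$2*y$5 + x$3*y$4 - x$4*y$3 - x$5*y$2 - x$6*y$1 + x$7*y$0"
  unfolding cayley_mult_def by (simp_all add: sum_8 cayley_coeff_def cayley_cyclic_eq)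

lemma bounded_bilinear_cayley_mult: "bounded_bilinear (\<star>)"
  unfolding bilinear_conv_bounded_bilinear[symmetric] bilinear_def
  by (auto intro!: linearI
      simp: cayley_mult_def vec_eq_iff sum.distrib algebra_simps scaleR_sum_right)

interpretation cayley: bounded_bilinear "(\<star>)"
  by (rule bounded_bilinear_cayley_mult)

lemma cayley_mult_vector_scale:
  "(c *s x) \<star> y = c *s (x \<star> y)" "x \<star> (c *s y) = c *s (x \<star> y)"
  by (simp_all add: cayley_mult_def vec_eq_iff sum_distrib_left mult_ac)

lemma cayley_unit_mult [simp]: "\<e> 0 \<star> x = x" "x \<star> \<e> 0 = x"
  by (simp_all add: vec_eq_8 cayley_mult_nth axis_def)

text \<open>The two alternative laws, polynomial identities in the coordinates, stand in for
  associativity; the linearized law and the Moufang identity below are derived from them.\<close>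

lemma cayley_left_alternative: "x \<star> (x \<star> y) = (x \<star> x) \<star> y"
  unfolding vec_eq_8 cayley_mult_nth by (intro conjI; algebra)

lemma cayley_right_alternative: "(y \<star> x) \<star> x = y \<star> (x \<star> x)"
  unfolding vec_eq_8 cayley_mult_nth by (intro conjI; algebra)

text \<open>Bilinear and not Hermitian, since this is the form preserved by \<open>SO8C\<close>; on
  real vectors it is the Euclidean inner product.\<close>

definition dotc :: "complex^8 \<Rightarrow> complex^8 \<Rightarrow> complex" where
  "dotc x y = (\<Sum>i\<in>UNIV. x $ i * y $ i)"

lemma dotc_simps:
  "dotc (x + y) z = dotc x z + dotc y z" "dotc x (y + z) = dotc x y + dotc x z"
  "dotc (x - y) z = dotc x z - dotc y z" "dotc x (y - z) = dotc x y - dotc x z"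
  "dotc (- x) z = - dotc x z" "dotc x (- z) = - dotc x z"
  "dotc (c *s x) z = c * dotc x z" "dotc x (c *s z) = c * dotc x z"
  by (simp_all add: dotc_def sum.distrib sum_subtractf sum_negf algebra_simps sum_distrib_left)

lemma dotc_commute: "dotc x y = dotc y x"
  by (simp add: dotc_def mult.commute)

lemma dotc_matrix: "dotc (A *v x) y = dotc x (transpose A *v y)"
  by (simp add: dotc_def matrix_vector_mult_def vector_matrix_mult_def sum_distrib_left
      sum_distrib_right mult_ac transpose_def del: transpose_matrix_vector) (rule sum.swap)

lemma dotc_orthogonal:
  assumes "transpose g ** g = mat 1"
  shows "dotc (g *v x) (g *v y) = dotc x y"
  by (metis dotc_matrix assms matrix_vector_mul_assoc matrix_vector_mul_lid)

lemma dotc_axis_0 [simp]: "dotc (\<e> 0) x = x $ 0" "dotc x (\<e> 0) = x $ 0"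
  by (simp_all add: dotc_def sum_8 axis_def)

lemma cayley_mult_0: "x $ 0 = 0 \<Longrightarrow> (x \<star> y) $ 0 = - dotc x y" "y $ 0 = 0 \<Longrightarrow> (x \<star> y) $ 0 = - dotc x y"
  by (simp_all add: cayley_mult_nth dotc_def sum_8)

text \<open>The polarized quadratic equation of the octonions. For orthogonal imaginary vectors the
  right-hand side vanishes, so that they anticommute.\<close>

lemma imaginary_anticommutator:
  assumes "u $ 0 = 0"
  shows "u \<star> x + x \<star> u = (2 * x $ 0) *s u - (2 * dotc u x) *s \<e> 0"
  using assms by (simp add: vec_eq_8 cayley_mult_nth dotc_def sum_8 axis_def algebra_simps)

lemma imaginary_square:
  assumes "u $ 0 = 0"
  shows "u \<star> u = - dotc u u *s \<e> 0"
  using imaginary_anticommutator[OF assms, of u] assms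
  by (simp add: vec_eq_iff algebra_simps)

lemma left_alternative_linear: "x \<star> (y \<star> z) + y \<star> (x \<star> z) = (x \<star> y + y \<star> x) \<star> z"
  using cayley_left_alternative[of "x + y" z] cayley_left_alternative[of x z] cayley_left_alternative[of y z]
  by (simp add: cayley.add_left cayley.add_right add_ac)

text \<open>As matrices, left multiplications compose associatively: x(yz) becomes a matrix product
  applied to z, and relations between products become matrix identities that can be
  differentiated.\<close>

definition lmat :: "complex^8 \<Rightarrow> complex^8^8" where
  "lmat x = (\<chi> k j. \<Sum>i\<in>UNIV. cayley_coeff i j k * x $ i)"

definition rmat :: "complex^8 \<Rightarrow> complex^8^8" where
  "rmat y = (\<chi> k i. \<Sum>j\<in>UNIV. cayley_coeff i j k * y $ j)"

lemma lmat_mult [simp]: "lmat x *v y = x \<star> y"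
  unfolding vec_eq_iff lmat_def matrix_vector_mult_def cayley_mult_def vec_lambda_beta sum_distrib_right
  by (intro allI sum.swap)

lemma rmat_mult [simp]: "rmat y *v x = x \<star> y"
  unfolding vec_eq_iff rmat_def matrix_vector_mult_def cayley_mult_def vec_lambda_beta sum_distrib_right
  by (intro allI, simp only: mult.assoc mult.commute mult.left_commute)

lemma matrix_eq_vectorI:
  fixes A B :: "complex^'m^'n"
  assumes "\<And>x. A *v x = B *v x"
  shows "A = B"
  using assms by (simp add: matrix_eq)

lemma bounded_linear_lmat: "bounded_linear lmat"
  unfolding linear_conv_bounded_linear[symmetric]
  by (auto intro!: linearI simp: lmat_def vec_eq_iff sum.distrib algebra_simps scaleR_sum_right)

lemma matrix_entry_axis: "A $ i $ j = (A *v \<e> j) $ i" for A :: "complex^8^8"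
  by (simp add: matrix_vector_mult_def axis_def if_distrib cong: if_cong)

lemma lmat_skew:
  assumes "u $ 0 = 0"
  shows "transpose (lmat u) = - lmat u"
  unfolding vec_eq_iff transpose_def vec_lambda_beta uminus_vec_def matrix_entry_axis[of "lmat u"] lmat_mult
  using assms by (simp add: forall_8 cayley_mult_nth axis_def)

lemma rmat_skew:
  assumes "u $ 0 = 0"
  shows "transpose (rmat u) = - rmat u"
  unfolding vec_eq_iff transpose_def vec_lambda_beta uminus_vec_def matrix_entry_axis[of "rmat u"] rmat_mult
  using assms by (simp add: forall_8 cayley_mult_nth axis_def)

lemma dotc_lmat_skew:
  assumes "u $ 0 = 0"
  shows "dotc (u \<star> x) y = - dotc x (u \<star> y)"
  using dotc_matrix[of "lmat u" x y] lmat_skew[OF assms]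
  by (simp add: dotc_simps del: transpose_matrix_vector)

text \<open>With a skew square root of \<open>-1\<close>, \<open>(1 + J)\<^sup>T (1 + J) = 2\<close> and \<open>(1 + J)\<^sup>2 = 2 J\<close>.\<close>
lemma skew_complex_structure_orthogonal:
  fixes J :: "complex^'n^'n"
  assumes skew: "transpose J = - J" and sq: "J ** J = - mat 1"
  shows "transpose J ** J = mat 1" "det J = 1"
proof -
  show "transpose J ** J = mat 1" by (simp add: skew sq)
  define K where "K = mat 1 + J"
  have "transpose K ** K = mat 1 + mat 1"
    by (simp add: K_def transpose_simps skew matrix_mult_distrib sq)
  moreover have two: "mat 1 + mat 1 = (mat 2 :: complex^'n^'n)" by (simp add: vec_eq_iff mat_def)
  ultimately have KK: "det K * det K = det (mat 2 :: complex^'n^'n)"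
    by (metis det_mul det_transpose)
  have "K ** K = mat 2 ** J"
    unfolding two[symmetric] by (simp only: K_def matrix_mult_distrib sq matrix_mul_lid matrix_mul_rid) simp
  then have "det K * det K = det (mat 2 :: complex^'n^'n) * det J"
    by (metis det_mul)
  moreover have "det (mat 2 :: complex^'n^'n) \<noteq> 0"
    by (subst det_diagonal) (simp_all add: mat_def)
  ultimately show "det J = 1" using KK by simp
qed

subsection \<open>The groups\<close>

lemma SO8C_iff: "g \<in> SO8C \<longleftrightarrow> det g = 1 \<and> transpose g ** g = mat 1"
  by (simp add: SO8C_def)

lemma SO8C_inverse:
  assumes "g \<in> SO8C"
  shows "transpose g ** g = mat 1" "g ** transpose g = mat 1"
  using assms matrix_left_right_inverse by (auto simp: SO8C_iff)

lemma SO8C_mult: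
  assumes "g \<in> SO8C" "h \<in> SO8C"
  shows "g ** h \<in> SO8C"
proof -
  have "transpose (g ** h) ** (g ** h) = transpose h ** (transpose g ** g) ** h"
    by (simp only: matrix_transpose_mul matrix_mul_assoc)
  then show ?thesis
    using assms by (simp add: SO8C_iff det_mul)
qed

lemma SO8C_transpose: "g \<in> SO8C \<Longrightarrow> transpose g \<in> SO8C"
  by (simp add: SO8C_iff det_transpose SO8C_inverse)

lemma SO8C_cancel:
  assumes "g \<in> SO8C"
  shows "transpose g *v (g *v x) = x" "g *v (transpose g *v x) = x"
  using SO8C_inverse[OF assms] by (simp_all only: matrix_vector_mul_assoc matrix_vector_mul_lid)

lemma SO7C_iff: "g \<in> SO7C \<longleftrightarrow> g \<in> SO8C \<and> g *v \<e> 0 = \<e> 0"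
  by (auto simp: SO7C_def)

lemma SO7C_mult: "g \<in> SO7C \<Longrightarrow> h \<in> SO7C \<Longrightarrow> g ** h \<in> SO7C"
  by (simp add: SO7C_iff SO8C_mult flip: matrix_vector_mul_assoc)

lemma SO7C_transpose: "g \<in> SO7C \<Longrightarrow> transpose g \<in> SO7C"
  unfolding SO7C_iff using SO8C_cancel(1)[of g "\<e> 0"] SO8C_transpose by metis

text \<open>For \<open>g\<close> in \<open>Spin7C\<close>, \<open>g0\<close> is its image under the
  double cover of \<open>SO7C\<close>. The variable y is absorbed into a matrix identity, which
  suits the differential equation for exponentials.\<close>

definition triality_pair :: "complex^8^8 \<Rightarrow> complex^8^8 \<Rightarrow> bool" where
  "triality_pair g0 g \<longleftrightarrow> (\<forall>x. lmat (g0 *v x) ** g = g ** lmat x)"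

lemma triality_pair_iff: "triality_pair g0 g \<longleftrightarrow> (\<forall>x y. (g0 *v x) \<star> (g *v y) = g *v (x \<star> y))"
  by (simp add: triality_pair_def matrix_eq flip: matrix_vector_mul_assoc)

lemma Spin7C_iff: "g \<in> Spin7C \<longleftrightarrow> g \<in> SO8C \<and> (\<exists>g0\<in>SO7C. triality_pair g0 g)"
  by (simp add: Spin7C_def triality_pair_iff)

lemma Spin7C_SO8C: "g \<in> Spin7C \<Longrightarrow> g \<in> SO8C"
  by (simp add: Spin7C_iff)

lemma triality_pair_mult:
  assumes "triality_pair g0 g" "triality_pair h0 h"
  shows "triality_pair (g0 ** h0) (g ** h)"
  using assms unfolding triality_pair_iff by (simp flip: matrix_vector_mul_assoc)

lemma Spin7C_mult: "g \<in> Spin7C \<Longrightarrow> h \<in> Spin7C \<Longrightarrow> g ** h \<in> Spin7C"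
  unfolding Spin7C_iff by (meson SO8C_mult SO7C_mult triality_pair_mult)

lemma triality_pair_transpose:
  assumes "g0 \<in> SO8C" "g \<in> SO8C" "triality_pair g0 g"
  shows "triality_pair (transpose g0) (transpose g)"
  using assms(3) unfolding triality_pair_iff by (metis SO8C_cancel assms(1,2))

lemma Spin7C_transpose: "g \<in> Spin7C \<Longrightarrow> transpose g \<in> Spin7C"
  unfolding Spin7C_iff by (meson SO8C_transpose SO7C_transpose SO7C_iff triality_pair_transpose)

text \<open>Choosing y as the preimage of e0 under \<open>g\<close> turns the left side of the
  triality relation into \<open>g0 *v x\<close>. Hence \<open>g\<close> determines
  \<open>g0\<close>; reality and differentiability of \<open>g0\<close> are read off from this
  formula.\<close>

lemma triality_pair_unique:
  assumes "g \<in> SO8C" "triality_pair g0 g"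
  shows "g0 *v x = g *v (x \<star> (transpose g *v \<e> 0))"
  using assms(2) unfolding triality_pair_iff by (metis SO8C_cancel(2)[OF assms(1)] cayley_unit_mult(2))

text \<open>An automorphism fixes the unit, because g e0 acts as a left unit on everything in the
  range of g, including e0. Conversely, y = e0 in the triality relation gives g0 = g.\<close>

lemma G2C_iff: "g \<in> G2C \<longleftrightarrow> g \<in> Spin7C \<and> g *v \<e> 0 = \<e> 0"
proof
  assume g: "g \<in> G2C"
  then have o: "g \<in> SO8C" and t: "triality_pair g g"
    by (auto simp: G2C_def triality_pair_iff)
  have "g *v \<e> 0 = \<e> 0"
    using t unfolding triality_pair_iff
    by (metis SO8C_cancel(2)[OF o] cayley_unit_mult)
  with o t show "g \<in> Spin7C \<and> g *v \<e> 0 = \<e> 0"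
    by (auto simp: Spin7C_iff SO7C_iff)
next
  assume g: "g \<in> Spin7C \<and> g *v \<e> 0 = \<e> 0"
  then obtain g0 where o: "g \<in> SO8C" and t: "triality_pair g0 g"
    by (auto simp: Spin7C_iff)
  have "g0 *v x = g *v x" for x
    using t g unfolding triality_pair_iff by (metis cayley_unit_mult(2))
  then show "g \<in> G2C" using o t by (simp add: G2C_def triality_pair_iff)
qed

section \<open>Real points\<close>

abbreviation real_matrix :: "complex^'m^'n \<Rightarrow> bool" where
  "real_matrix g \<equiv> \<forall>i j. g $ i $ j \<in> \<real>"

lemma cayley_real_simps:
  "x \<in> cayley_real \<Longrightarrow> y \<in> cayley_real \<Longrightarrow> x + y \<in> cayley_real"
  "x \<in> cayley_real \<Longrightarrow> y \<in> cayley_real \<Longrightarrow> x - y \<in> cayley_real"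
  "x \<in> cayley_real \<Longrightarrow> - x \<in> cayley_real"
  "x \<in> cayley_real \<Longrightarrow> y \<in> cayley_real \<Longrightarrow> x \<star> y \<in> cayley_real"
  "c \<in> \<real> \<Longrightarrow> x \<in> cayley_real \<Longrightarrow> c *s x \<in> cayley_real"
  "real_matrix g \<Longrightarrow> x \<in> cayley_real \<Longrightarrow> g *v x \<in> cayley_real"
  "\<e> i \<in> cayley_real"
proof -
  show "x \<in> cayley_real \<Longrightarrow> y \<in> cayley_real \<Longrightarrow> x \<star> y \<in> cayley_real"
    unfolding cayley_real_def mem_Collect_eq cayley_mult_def vec_lambda_beta
    by (intro allI sum_in_Reals Reals_mult) (auto simp: cayley_coeff_def)
  show "real_matrix g \<Longrightarrow> x \<in> cayley_real \<Longrightarrow> g *v x \<in> cayley_real"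
    unfolding cayley_real_def mem_Collect_eq matrix_vector_mult_def vec_lambda_beta
    by (intro allI sum_in_Reals Reals_mult) auto
qed (auto simp: cayley_real_def axis_def)

lemma real_matrix_iff: "real_matrix (g :: complex^8^8) \<longleftrightarrow> (\<forall>j. g *v \<e> j \<in> cayley_real)"
  unfolding cayley_real_def mem_Collect_eq matrix_entry_axis[of g] by blast

lemma real_matrix_lmat: "u \<in> cayley_real \<Longrightarrow> real_matrix (lmat u)"
  unfolding real_matrix_iff by (simp add: cayley_real_simps)

lemma real_matrix_mult: "real_matrix g \<Longrightarrow> real_matrix h \<Longrightarrow> real_matrix (g ** h)" for g h :: "complex^8^8"
  unfolding matrix_mult_entry by (intro allI sum_in_Reals Reals_mult) auto

lemma real_matrix_transpose: "real_matrix g \<Longrightarrow> real_matrix (transpose g)"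
  by (simp add: transpose_def)

lemma cayley_real_decomp:
  obtains a b where "a \<in> cayley_real" "b \<in> cayley_real" "x = a + \<i> *s b"
proof
  show "(\<chi> i. of_real (Re (x $ i))) \<in> cayley_real" "(\<chi> i. of_real (Im (x $ i))) \<in> cayley_real"
    by (simp_all add: cayley_real_def)
  show "x = (\<chi> i. of_real (Re (x $ i))) + \<i> *s (\<chi> i. of_real (Im (x $ i)))"
    by (simp add: vec_eq_iff complex_eq_iff)
qed

text \<open>\<open>Spin7\<close> tests its relation on real vectors only and asks for a real
  \<open>g0\<close>. Bilinearity extends the relation to complex vectors; in the other direction,
  the formula for \<open>g0\<close> in terms of \<open>g\<close> shows that it is real.\<close>

lemma Spin7_iff: "g \<in> Spin7 \<longleftrightarrow> g \<in> Spin7C \<and> real_matrix g"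
proof
  assume "g \<in> Spin7"
  then obtain g0 where g: "g \<in> SO8C" "real_matrix g" and g0: "g0 \<in> SO7C"
    and eq: "\<And>x y. x \<in> cayley_real \<Longrightarrow> y \<in> cayley_real \<Longrightarrow> (g0 *v x) \<star> (g *v y) = g *v (x \<star> y)"
    by (auto simp: Spin7_def SO8_def SO7_def)
  have "(g0 *v x) \<star> (g *v y) = g *v (x \<star> y)" for x y
  proof -
    obtain a b where x: "a \<in> cayley_real" "b \<in> cayley_real" "x = a + \<i> *s b"
      by (rule cayley_real_decomp)
    obtain c d where y: "c \<in> cayley_real" "d \<in> cayley_real" "y = c + \<i> *s d"
      by (rule cayley_real_decomp)
    show ?thesis
      unfolding x(3) y(3) using x(1,2) y(1,2)
      by (simp add: matrix_vector_right_distrib vector_scalar_commute cayley.add_left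
          cayley.add_right cayley.diff_left cayley.diff_right matrix_vector_mult_diff_distrib
          cayley_mult_vector_scale eq)
  qed
  with g g0 show "g \<in> Spin7C \<and> real_matrix g"
    by (auto simp: Spin7C_iff triality_pair_iff)
next
  assume g: "g \<in> Spin7C \<and> real_matrix g"
  then obtain g0 where o: "g \<in> SO8C" and g0: "g0 \<in> SO7C" and t: "triality_pair g0 g"
    by (auto simp: Spin7C_iff)
  have r: "real_matrix g" "real_matrix (transpose g)" using g real_matrix_transpose by blast+
  have "real_matrix g0"
    unfolding real_matrix_iff triality_pair_unique[OF o t]
    by (intro allI cayley_real_simps(6)[OF r(1)] cayley_real_simps(6)[OF r(2)] cayley_real_simps(4,7))
  with g o g0 t show "g \<in> Spin7"
    by (auto simp: Spin7_def SO8_def SO7_def triality_pair_iff)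
qed

lemma Spin7_mult: "g \<in> Spin7 \<Longrightarrow> h \<in> Spin7 \<Longrightarrow> g ** h \<in> Spin7"
  by (simp add: Spin7_iff Spin7C_mult real_matrix_mult)

lemma Spin7_transpose: "g \<in> Spin7 \<Longrightarrow> transpose g \<in> Spin7"
  by (simp add: Spin7_iff Spin7C_transpose real_matrix_transpose)

lemma imaginary_unit_square:
  assumes "u $ 0 = 0" "dotc u u = 1"
  shows "u \<star> u = - \<e> 0"
  using imaginary_square[OF assms(1)] by (simp add: assms(2))

lemma imaginary_unit_mult_twice:
  assumes "u $ 0 = 0" "dotc u u = 1"
  shows "u \<star> (u \<star> x) = - x" "(x \<star> u) \<star> u = - x"
  by (simp_all add: cayley_left_alternative cayley_right_alternative imaginary_unit_square[OF assms]
      cayley.minus_left cayley.minus_right)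

text \<open>The anticommutator A = ux + xu is a combination of u and e0, so left alternativity gives
  (Au)z = A(uz); the remaining terms reduce by u(uz) = -z.\<close>

lemma Moufang_imaginary_unit:
  assumes u: "u $ 0 = 0" "dotc u u = 1"
  shows "((u \<star> x) \<star> u) \<star> z = u \<star> (x \<star> (u \<star> z))"
proof -
  define A where "A = (2 * x $ 0) *s u - (2 * dotc u x) *s \<e> 0"
  have A: "u \<star> x = A - x \<star> u"
    using imaginary_anticommutator[OF u(1), of x] by (simp add: A_def algebra_simps)
  have "((u \<star> x) \<star> u) \<star> z = (A \<star> u) \<star> z + x \<star> z"
    by (simp add: A cayley.diff_left cayley.add_left imaginary_unit_mult_twice[OF u] cayley.minus_left)
  also have "(A \<star> u) \<star> z = A \<star> (u \<star> z)"
    by (simp add: A_def cayley.diff_left cayley_mult_vector_scale cayley_left_alternative)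
  also have "A \<star> (u \<star> z) = u \<star> (x \<star> (u \<star> z)) + x \<star> (u \<star> (u \<star> z))"
    using left_alternative_linear[of u x "u \<star> z"] A by simp
  finally show ?thesis
    by (simp add: imaginary_unit_mult_twice[OF u] cayley.minus_right)
qed

text \<open>The covering transformation of \<open>lmat u\<close> is \<open>x \<mapsto> u x u\<^sup>-\<^sup>1 = - (u x) u\<close>.\<close>
lemma lmat_Spin7C:
  assumes u: "u $ 0 = 0" "dotc u u = 1"
  shows "lmat u \<in> Spin7C"
proof -
  have L: "lmat u ** lmat u = - mat 1"
    by (intro matrix_eq_vectorI) (simp add: imaginary_unit_mult_twice[OF u] flip: matrix_vector_mul_assoc)
  have R: "rmat (- u) ** rmat (- u) = - mat 1"
    by (intro matrix_eq_vectorI)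
       (simp add: imaginary_unit_mult_twice[OF u] cayley.minus_left cayley.minus_right flip: matrix_vector_mul_assoc)
  have lS: "lmat u \<in> SO8C"
    using skew_complex_structure_orthogonal[OF lmat_skew[OF u(1)] L] by (simp add: SO8C_iff)
  have rS: "rmat (- u) \<in> SO8C"
    using skew_complex_structure_orthogonal[OF rmat_skew R] u by (simp add: SO8C_iff)
  have g0: "(rmat (- u) ** lmat u) *v x = - ((u \<star> x) \<star> u)" for x
    by (simp add: cayley.minus_right flip: matrix_vector_mul_assoc)
  have "rmat (- u) ** lmat u \<in> SO7C"
    unfolding SO7C_iff g0 using lS rS SO8C_mult imaginary_unit_square[OF u] by simp
  \<comment> \<open>The Moufang identity at z = uy gives -((ux)u)(uy) = -u(x(u(uy))) =
    u(xy).\<close>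
  moreover have "triality_pair (rmat (- u) ** lmat u) (lmat u)"
    unfolding triality_pair_iff g0
    by (simp add: cayley.minus_left Moufang_imaginary_unit[OF u] imaginary_unit_mult_twice[OF u] cayley.minus_right)
  ultimately show ?thesis using lS by (auto simp: Spin7C_iff)
qed

lemma lmat_Spin7: "u $ 0 = 0 \<Longrightarrow> dotc u u = 1 \<Longrightarrow> u \<in> cayley_real \<Longrightarrow> lmat u \<in> Spin7"
  by (simp add: Spin7_iff lmat_Spin7C real_matrix_lmat)

subsection \<open>The Lie algebra of Spin(7,C) and traces\<close>

text \<open>Infinitesimal triality, X(xy) = (X0 x)y + x(Xy), together with the linearized conditions
  that the pair lies in \<open>SO7C\<close> and \<open>SO8C\<close>. These conditions are linear
  over the complex numbers.\<close>

definition triality_algebra :: "complex^8^8 \<Rightarrow> complex^8^8 \<Rightarrow> bool" where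
  "triality_algebra X0 X \<longleftrightarrow> transpose X = - X \<and> transpose X0 = - X0 \<and> X0 *v \<e> 0 = 0 \<and>
     (\<forall>x. X ** lmat x = lmat (X0 *v x) + lmat x ** X)"

lemma triality_algebra_mexp:
  assumes "triality_algebra X0 X"
  shows "mexp (t *\<^sub>R X) \<in> Spin7C"
proof -
  have X: "transpose X = - X" "transpose X0 = - X0" "X0 *v \<e> 0 = 0"
    and pair: "\<And>x. X ** lmat x = lmat (X0 *v x) + lmat x ** X"
    using assms by (auto simp: triality_algebra_def)
  have "\<e> 0 = mexp (t *\<^sub>R X0) *v \<e> 0"
    by (rule mexp_ode_vector_unique[of "\<lambda>_. \<e> 0"]) (simp add: X)
  then have "mexp (t *\<^sub>R X0) \<in> SO7C"
    using mexp_skew_orthogonal[OF X(2), of t] by (simp add: SO7C_iff SO8C_iff)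
  moreover have "triality_pair (mexp (t *\<^sub>R X0)) (mexp (t *\<^sub>R X))"
    unfolding triality_pair_def
  proof
    fix x
    \<comment> \<open>The infinitesimal relation, applied at the moving vector, shows that
      \<open>?F\<close> solves F' = X F with initial value \<open>lmat x\<close>; so does the
      right-hand side of the goal.\<close>
    let ?F = "\<lambda>t. lmat (mexp (t *\<^sub>R X0) *v x) ** mexp (t *\<^sub>R X)"
    have "(?F has_vector_derivative X ** ?F t) (at t)" for t
    proof -
      have "((\<lambda>t. mexp (t *\<^sub>R X0) *v x) has_vector_derivative (X0 ** mexp (t *\<^sub>R X0)) *v x) (at t)"
        using bounded_bilinear.has_vector_derivative[OF bounded_bilinear_matrix_vector_mult
            mexp_deriv[of X0 t] has_vector_derivative_const[of x]] by simp
      from matrix_mult_deriv[OF bounded_linear.has_vector_derivative[OF bounded_linear_lmat this]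
          mexp_deriv[of X t]]
      show ?thesis
        by (simp add: pair matrix_mul_assoc matrix_mult_distrib add.commute flip: matrix_vector_mul_assoc)
    qed
    from mexp_ode_unique[of ?F, OF this, of t]
    show "lmat (mexp (t *\<^sub>R X0) *v x) ** mexp (t *\<^sub>R X) = mexp (t *\<^sub>R X) ** lmat x" by simp
  qed
  ultimately show ?thesis
    using mexp_skew_orthogonal[OF X(1), of t] by (auto simp: Spin7C_iff SO8C_iff)
qed

lemma skew_if_mexp_SO8C:
  assumes "\<And>t. mexp (t *\<^sub>R X) \<in> SO8C"
  shows "transpose X = - X"
proof -
  have "((\<lambda>t. transpose (mexp (t *\<^sub>R X)) ** mexp (t *\<^sub>R X)) has_vector_derivative X + transpose X) (at 0)"
    using matrix_mult_deriv[OF bounded_linear.has_vector_derivative[OF bounded_linear_transpose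
          mexp_deriv_0[of X]] mexp_deriv_0[of X]] by simp
  moreover have "(\<lambda>t. transpose (mexp (t *\<^sub>R X)) ** mexp (t *\<^sub>R X)) = (\<lambda>t. mat 1)"
    using assms by (simp add: SO8C_iff)
  ultimately have "X + transpose X = 0"
    by (metis has_vector_derivative_const vector_derivative_unique_at)
  then show ?thesis by (simp add: add_eq_0_iff)
qed

text \<open>For the harder inclusion the covering elements are replaced by their formula in terms of
  \<open>mexp (t *\<^sub>R X)\<close>, after which the triality relation can be differentiated at
  0.\<close>

lemma lie_algebra_Spin7C: "lie_algebra Spin7C = {X. \<exists>X0. triality_algebra X0 X}"
proof (intro subset_antisym subsetI)
  fix X assume "X \<in> {X. \<exists>X0. triality_algebra X0 X}"
  then show "X \<in> lie_algebra Spin7C"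
    by (auto simp: lie_algebra_def triality_algebra_mexp)
next
  fix X assume "X \<in> lie_algebra Spin7C"
  then have G: "mexp (t *\<^sub>R X) \<in> Spin7C" for t
    by (simp add: lie_algebra_def)
  then have skew: "transpose X = - X"
    by (intro skew_if_mexp_SO8C Spin7C_SO8C)
  let ?v = "X *v \<e> 0"
  \<comment> \<open>The derivative at 0 of the formula for the covering element: moving the outer
    factor contributes X x, moving the inner one contributes -x(X e0).\<close>
  define X0 where "X0 = X - rmat ?v"
  \<comment> \<open>A skew X makes X e0 imaginary, hence its right multiplication skew, and
    therefore \<open>X0\<close> skew.\<close>
  have "X $ 0 $ 0 = - X $ 0 $ 0"
    using arg_cong[OF skew, of "\<lambda>M. M $ 0 $ 0"] by (simp add: transpose_def)
  then have v0: "?v $ 0 = 0"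
    unfolding matrix_entry_axis[symmetric] by simp
  have "X ** lmat x = lmat (X0 *v x) + lmat x ** X" for x
  proof -
    let ?E = "\<lambda>t. mexp (t *\<^sub>R X)"
    have T: "((\<lambda>t. transpose (?E t) *v \<e> 0) has_vector_derivative - ?v) (at 0)"
      using bounded_bilinear.has_vector_derivative[OF bounded_bilinear_matrix_vector_mult
          mexp_deriv_0[of "- X"] has_vector_derivative_const[of "\<e> 0"]]
      by (simp add: transpose_mexp skew del: transpose_matrix_vector)
    have "((\<lambda>t. x \<star> (transpose (?E t) *v \<e> 0)) has_vector_derivative - (x \<star> ?v)) (at 0)"
      using cayley.has_vector_derivative[OF has_vector_derivative_const[of x] T]
      by (simp add: cayley.minus_right)
    from bounded_bilinear.has_vector_derivative[OF bounded_bilinear_matrix_vector_mult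
        mexp_deriv_0[of X] this]
    have "((\<lambda>t. ?E t *v (x \<star> (transpose (?E t) *v \<e> 0))) has_vector_derivative X0 *v x) (at 0)"
      by (simp add: X0_def matrix_vector_mult_diff_rdistrib)
    from matrix_mult_deriv[OF bounded_linear.has_vector_derivative[OF bounded_linear_lmat this]
        mexp_deriv_0[of X]]
    have 1: "((\<lambda>t. lmat (?E t *v (x \<star> (transpose (?E t) *v \<e> 0))) ** ?E t)
        has_vector_derivative lmat x ** X + lmat (X0 *v x)) (at 0)"
      by simp
    have 2: "((\<lambda>t. ?E t ** lmat x) has_vector_derivative X ** lmat x) (at 0)"
      using matrix_mult_deriv[OF mexp_deriv_0[of X] has_vector_derivative_const[of "lmat x"]] by simp
    have "lmat (?E t *v (x \<star> (transpose (?E t) *v \<e> 0))) ** ?E t = ?E t ** lmat x" for t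
      using G[of t] by (auto simp: Spin7C_iff triality_pair_def simp del: transpose_matrix_vector
          simp flip: triality_pair_unique)
    with 1 2 show ?thesis
      by (metis (no_types, lifting) ext add.commute vector_derivative_unique_at)
  qed
  then have "triality_algebra X0 X"
    by (simp add: triality_algebra_def skew X0_def transpose_simps rmat_skew[OF v0]
        matrix_vector_mult_diff_rdistrib)
  then show "X \<in> {X. \<exists>X0. triality_algebra X0 X}" by blast
qed

section \<open>Closure properties of the Lie algebra, and traces on it\<close>

lemma triality_algebra_add:
  "triality_algebra X0 X \<Longrightarrow> triality_algebra Y0 Y \<Longrightarrow> triality_algebra (X0 + Y0) (X + Y)"
  by (simp add: triality_algebra_def transpose_simps matrix_mult_distrib matrix_vector_mult_add_rdistrib
      linear_add[OF bounded_linear.linear[OF bounded_linear_lmat]])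

lemma cscale_mult:
  fixes A :: "complex^'n^'n"
  shows "(c *\<^sub>C A) ** B = c *\<^sub>C (A ** B)" "A ** (c *\<^sub>C B) = c *\<^sub>C (A ** B)"
    "(c *\<^sub>C A) *v x = c *s (A *v x)" "transpose (c *\<^sub>C A) = c *\<^sub>C transpose A"
  by (simp_all add: cscale_def vec_eq_iff matrix_mult_entry matrix_vector_mult_def transpose_def
      sum_distrib_left mult_ac)

lemma lmat_vector_scale: "lmat (c *s x) = c *\<^sub>C lmat x"
  by (simp add: lmat_def cscale_def vec_eq_iff sum_distrib_left mult_ac)

lemma triality_algebra_cscale:
  "triality_algebra X0 X \<Longrightarrow> triality_algebra (c *\<^sub>C X0) (c *\<^sub>C X)"
  by (simp add: triality_algebra_def cscale_mult lmat_vector_scale cmat.scale_right_distrib)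

lemma triality_algebra_zero: "triality_algebra 0 0"
  by (simp add: triality_algebra_def transpose_def vec_eq_iff)
     (simp add: lmat_def)

lemma triality_algebra_bracket:
  assumes "triality_algebra X0 X" "triality_algebra Y0 Y"
  shows "triality_algebra (lie_bracket X0 Y0) (lie_bracket X Y)"
proof -
  have X: "transpose X = - X" "transpose X0 = - X0" "X0 *v \<e> 0 = 0" "\<And>x. X ** lmat x = lmat (X0 *v x) + lmat x ** X"
   and Y: "transpose Y = - Y" "transpose Y0 = - Y0" "Y0 *v \<e> 0 = 0" "\<And>x. Y ** lmat x = lmat (Y0 *v x) + lmat x ** Y"
    using assms by (auto simp: triality_algebra_def)
  have "(X ** Y - Y ** X) ** lmat x = lmat ((X0 ** Y0 - Y0 ** X0) *v x) + lmat x ** (X ** Y - Y ** X)" for x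
  proof -
    have "X ** (Y ** lmat x) = lmat (X0 *v (Y0 *v x)) + lmat (Y0 *v x) ** X + (lmat (X0 *v x) + lmat x ** X) ** Y"
      unfolding Y(4) matrix_mult_distrib X(4) by (simp add: matrix_mul_assoc X(4) matrix_mult_distrib)
    moreover have "Y ** (X ** lmat x) = lmat (Y0 *v (X0 *v x)) + lmat (X0 *v x) ** Y + (lmat (Y0 *v x) + lmat x ** Y) ** X"
      unfolding X(4) matrix_mult_distrib Y(4) by (simp add: matrix_mul_assoc Y(4) matrix_mult_distrib)
    ultimately show ?thesis
      by (simp add: matrix_mult_distrib matrix_vector_mult_diff_rdistrib matrix_mul_assoc
          linear_diff[OF bounded_linear.linear[OF bounded_linear_lmat]] flip: matrix_vector_mul_assoc)
  qed
  moreover have "transpose (lie_bracket X Y) = - lie_bracket X Y" "transpose (lie_bracket X0 Y0) = - lie_bracket X0 Y0"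
    by (simp_all add: lie_bracket_def transpose_simps matrix_transpose_mul X Y)
  moreover have "lie_bracket X0 Y0 *v \<e> 0 = 0"
    by (simp add: lie_bracket_def matrix_vector_mult_diff_rdistrib X Y flip: matrix_vector_mul_assoc)
  ultimately show ?thesis by (simp add: triality_algebra_def lie_bracket_def)
qed

text \<open>A subspace over the complex numbers, as \<open>trace_on\<close> requires: only then does
  a basis exist whose complex span is the Lie algebra.\<close>

lemma subspace_lie_algebra_Spin7C: "cmat.subspace (lie_algebra Spin7C)"
  unfolding lie_algebra_Spin7C
  by (rule cmat.subspaceI)
     (blast intro: triality_algebra_zero triality_algebra_add triality_algebra_cscale)+

lemma lie_bracket_Spin7C:
  "X \<in> lie_algebra Spin7C \<Longrightarrow> Y \<in> lie_algebra Spin7C \<Longrightarrow> lie_bracket X Y \<in> lie_algebra Spin7C"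
  unfolding lie_algebra_Spin7C using triality_algebra_bracket by blast

lemma adjoint_Spin7C:
  assumes "X \<in> lie_algebra Spin7C" "k \<in> Spin7C"
  shows "k ** X ** transpose k \<in> lie_algebra Spin7C"
  using assms mexp_conj[of "transpose k" k] SO8C_inverse(1)[OF Spin7C_SO8C[OF assms(2)]]
  by (simp add: lie_algebra_def Spin7C_mult Spin7C_transpose)

text \<open>The choice inside \<open>trace_on\<close> depends on \<open>V\<close> alone, so a single
  basis serves all endomorphisms; additivity and cyclicity of the trace rest on this.\<close>

lemma trace_on_basis:
  assumes "cmat.subspace V"
  obtains B where "cmat.independent B" "cmat.span B = V"
    "\<forall>f. trace_on V f = (\<Sum>b\<in>B. cmat.representation B (f b) b)"
proof -
  have "\<exists>B. cmat.independent B \<and> cmat.span B = V"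
    using cmat.basis_exists[of V] assms cmat.span_minimal by (metis subset_antisym)
  from someI_ex[OF this] show ?thesis
    by (intro that) (auto simp: trace_on_def Let_def)
qed

lemma trace_on_add:
  assumes V: "cmat.subspace V" and "\<And>x. x \<in> V \<Longrightarrow> f x \<in> V" "\<And>x. x \<in> V \<Longrightarrow> g x \<in> V"
  shows "trace_on V (\<lambda>x. f x + g x) = trace_on V f + trace_on V g"
proof -
  obtain B where B: "cmat.independent B" "cmat.span B = V"
    "\<forall>f. trace_on V f = (\<Sum>b\<in>B. cmat.representation B (f b) b)"
    using trace_on_basis[OF V] by blast
  have "B \<subseteq> V" using B(2) cmat.span_superset by blast
  then show ?thesis
    unfolding B(3)[rule_format] sum.distrib[symmetric]
    by (intro sum.cong refl) (use assms B in \<open>auto simp: cmat.representation_add\<close>)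
qed

lemma representation_linear_image:
  assumes B: "cmat.independent B" "cmat.span B = V" "finite B"
    and f: "Vector_Spaces.linear cscale cscale f" "\<And>x. x \<in> V \<Longrightarrow> f x \<in> V"
    and x: "x \<in> V"
  shows "cmat.representation B (f x) b = (\<Sum>c\<in>B. cmat.representation B x c * cmat.representation B (f c) b)"
proof -
  interpret f: Vector_Spaces.linear cscale cscale f by (rule f(1))
  have "B \<subseteq> V" using B(2) cmat.span_superset by blast
  have "x = (\<Sum>c\<in>B. cmat.representation B x c *\<^sub>C c)"
    using cmat.sum_representation_eq[OF B(1) _ B(3) order_refl] x B(2) by simp
  then have "f x = (\<Sum>c\<in>B. cmat.representation B x c *\<^sub>C f c)"
    by (metis (no_types, lifting) f.scale f.sum sum.cong)
  moreover have "cmat.representation B (\<Sum>c\<in>B. cmat.representation B x c *\<^sub>C f c) b =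
      (\<Sum>c\<in>B. cmat.representation B (cmat.representation B x c *\<^sub>C f c) b)"
    using \<open>B \<subseteq> V\<close> f(2) B(2) by (subst cmat.representation_sum[OF B(1)]) (auto intro: cmat.span_scale)
  ultimately show ?thesis
    using \<open>B \<subseteq> V\<close> f(2) B(2)
    by (auto intro!: sum.cong simp: cmat.representation_scale[OF B(1)])
qed

lemma trace_on_commute:
  assumes V: "cmat.subspace V"
    and f: "Vector_Spaces.linear cscale cscale f" "\<And>x. x \<in> V \<Longrightarrow> f x \<in> V"
    and g: "Vector_Spaces.linear cscale cscale g" "\<And>x. x \<in> V \<Longrightarrow> g x \<in> V"
  shows "trace_on V (\<lambda>x. f (g x)) = trace_on V (\<lambda>x. g (f x))"
proof -
  obtain B where B: "cmat.independent B" "cmat.span B = V"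
    "\<forall>f. trace_on V f = (\<Sum>b\<in>B. cmat.representation B (f b) b)"
    using trace_on_basis[OF V] by blast
  have BV: "B \<subseteq> V" using B(2) cmat.span_superset by blast
  show ?thesis
  \<comment> \<open>Sums over an infinite set are 0, which makes both traces vanish in that case;
    finiteness of the chosen basis is not established.\<close>
  proof (cases "finite B")
    case True
    note rf = representation_linear_image[OF B(1,2) True f] and rg = representation_linear_image[OF B(1,2) True g]
    have "trace_on V (\<lambda>x. f (g x)) = (\<Sum>b\<in>B. \<Sum>c\<in>B. cmat.representation B (g b) c * cmat.representation B (f c) b)"
      unfolding B(3)[rule_format] using BV g(2) by (intro sum.cong refl rf) auto
    also have "\<dots> = (\<Sum>c\<in>B. \<Sum>b\<in>B. cmat.representation B (f c) b * cmat.representation B (g b) c)"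
      by (subst sum.swap) (simp only: mult.commute)
    also have "\<dots> = trace_on V (\<lambda>x. g (f x))"
      unfolding B(3)[rule_format] using BV f(2) by (intro sum.cong refl rg[symmetric]) auto
    finally show ?thesis .
  qed (simp add: B(3))
qed

subsection \<open>Killing orthogonality\<close>

lemma lie_bracket_distrib:
  "lie_bracket (X + Y) Z = lie_bracket X Z + lie_bracket Y Z"
  "lie_bracket X (Y + Z) = lie_bracket X Y + lie_bracket X Z"
  by (simp_all add: lie_bracket_def matrix_mult_distrib)

lemma linear_lie_bracket: "Vector_Spaces.linear cscale cscale (lie_bracket X)"
  by unfold_locales (simp_all add: lie_bracket_def matrix_mult_distrib cscale_mult
      cmat.scale_right_diff_distrib algebra_simps)

lemma linear_conjugation:
  fixes k l :: "complex^'n^'n"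
  shows "Vector_Spaces.linear cscale cscale (\<lambda>Z. k ** Z ** l)"
  by unfold_locales (simp_all add: matrix_mult_distrib cscale_mult)

lemma linear_cscale_comp:
  assumes "Vector_Spaces.linear cscale cscale f" "Vector_Spaces.linear cscale cscale g"
  shows "Vector_Spaces.linear cscale cscale (\<lambda>x. f (g x))"
  using Vector_Spaces.linear_compose[OF assms(2,1)] by (simp add: o_def)

lemma killing_form_add_right:
  assumes "X \<in> lie_algebra Spin7C" "Y \<in> lie_algebra Spin7C" "Y' \<in> lie_algebra Spin7C"
  shows "killing_form (lie_algebra Spin7C) X (Y + Y') =
    killing_form (lie_algebra Spin7C) X Y + killing_form (lie_algebra Spin7C) X Y'"
  unfolding killing_form_def lie_bracket_distrib
  by (intro trace_on_add subspace_lie_algebra_Spin7C lie_bracket_Spin7C assms)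

lemma lie_bracket_conjugate:
  assumes "l ** k = mat 1"
  shows "lie_bracket (k ** X ** l) (k ** Y ** l) = k ** lie_bracket X Y ** l"
proof -
  have *: "(k ** X ** l) ** (k ** Y ** l) = k ** (X ** Y) ** l" for X Y
    by (simp only: matrix_mul_assoc[symmetric]) (simp add: matrix_mul_assoc assms)
  show ?thesis
    by (simp add: lie_bracket_def * matrix_mult_distrib)
qed

text \<open>The composite ad(kXk') ad(kYk'), with k' the transpose of k, is conjugate to ad(X) ad(Y)
  under Z \<mapsto> kZk'. Cyclicity of the trace moves one factor to the other end, where the two
  conjugations cancel.\<close>

lemma killing_form_adjoint:
  assumes k: "k \<in> Spin7C" and X: "X \<in> lie_algebra Spin7C" and Y: "Y \<in> lie_algebra Spin7C"
  shows "killing_form (lie_algebra Spin7C) (k ** X ** transpose k) (k ** Y ** transpose k) =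
    killing_form (lie_algebra Spin7C) X Y"
proof -
  let ?L = "lie_algebra Spin7C"
  let ?f = "\<lambda>Z. k ** Z ** transpose k"
  let ?f' = "\<lambda>Z. transpose k ** Z ** k"
  let ?h = "\<lambda>Z. lie_bracket X (lie_bracket Y (?f' Z))"
  note kk = SO8C_inverse[OF Spin7C_SO8C[OF k]]
  have ff': "?f (?f' Z) = Z" "?f' (?f Z) = Z" for Z
    by (simp_all only: matrix_mul_assoc[symmetric] kk matrix_mul_rid)
       (simp_all only: matrix_mul_assoc kk matrix_mul_lid)
  have "lie_bracket (?f X) (lie_bracket (?f Y) Z) = ?f (?h Z)" for Z
    using lie_bracket_conjugate[OF kk(1)] ff'(1)[of Z] by metis
  then have "killing_form ?L (?f X) (?f Y) = trace_on ?L (\<lambda>Z. ?f (?h Z))"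
    by (simp only: killing_form_def)
  also have "\<dots> = trace_on ?L (\<lambda>Z. ?h (?f Z))"
  proof (rule trace_on_commute[OF subspace_lie_algebra_Spin7C])
    show "?f Z \<in> ?L" if "Z \<in> ?L" for Z
      using adjoint_Spin7C[OF that k] .
    show "?h Z \<in> ?L" if "Z \<in> ?L" for Z
      using adjoint_Spin7C[OF that Spin7C_transpose[OF k]] X Y by (simp add: lie_bracket_Spin7C)
    show "Vector_Spaces.linear cscale cscale ?f"
      by (rule linear_conjugation)
    show "Vector_Spaces.linear cscale cscale ?h"
      by (rule linear_cscale_comp[OF linear_lie_bracket linear_cscale_comp[OF linear_lie_bracket linear_conjugation]])
  qed
  also have "\<dots> = killing_form ?L X Y"
    by (simp only: killing_form_def ff')
  finally show ?thesis .
qed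

lemma lie_algebra_mono: "G \<subseteq> H \<Longrightarrow> lie_algebra G \<subseteq> lie_algebra H"
  by (auto simp: lie_algebra_def)

lemma lie_algebra_G2C_derivation:
  assumes "Y \<in> lie_algebra G2C"
  shows "Y *v (x \<star> y) = (Y *v x) \<star> y + x \<star> (Y *v y)"
proof -
  let ?E = "\<lambda>t. mexp (t *\<^sub>R Y)"
  have E: "((\<lambda>t. ?E t *v z) has_vector_derivative Y *v z) (at 0)" for z
    using bounded_bilinear.has_vector_derivative[OF bounded_bilinear_matrix_vector_mult
        mexp_deriv_0[of Y] has_vector_derivative_const[of z]] by simp
  have "(?E t *v x) \<star> (?E t *v y) = ?E t *v (x \<star> y)" for t
    using assms by (simp add: lie_algebra_def G2C_def)
  then show ?thesis
    using cayley.has_vector_derivative[OF E[of x] E[of y]] E[of "x \<star> y"]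
    by (simp add: add.commute vector_derivative_unique_at)
qed

section \<open>The torus and automorphisms commuting with it\<close>

definition sign_matrix :: "8 set \<Rightarrow> complex^8^8" where
  "sign_matrix S = (\<chi> i j. if i = j then (if i \<in> S then - 1 else 1) else 0)"

text \<open>The induced matrix fixes e0 and e1 and sends e2 to e4, e4 to e6, e6 to e2, and likewise
  e3 to e5, e5 to e7, e7 to e3. It commutes with left multiplication by e1: it is a cyclic
  permutation of three complex coordinates with complex structure e1.\<close>

definition cyclic_perm :: "8 \<Rightarrow> 8" where
  "cyclic_perm i = (if i = 2 then 6 else if i = 3 then 7 else if i = 4 then 2 else if i = 5 then 3
     else if i = 6 then 4 else if i = 7 then 5 else i)"

definition cyclic_matrix :: "complex^8^8" where
  "cyclic_matrix = (\<chi> i j. if j = cyclic_perm i then 1 else 0)"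

text \<open>Complex parameters cover at once the elements of \<open>a0_tilde\<close>, their real
  counterparts in the Lie algebra of \<open>Spin7\<close>, and the covering elements
  \<open>torus 0 (2 * r)\<close>.\<close>

definition torus :: "complex \<Rightarrow> complex \<Rightarrow> complex^8^8" where
  "torus p q = (\<chi> i j.
     if i = 1 \<and> j = 0 then p else if i = 0 \<and> j = 1 then - p
     else if (i, j) \<in> {(3, 2), (5, 4), (7, 6)} then q
     else if (i, j) \<in> {(2, 3), (4, 5), (6, 7)} then - q else 0)"

lemma torus_mult:
  "(torus p q *v x) $ 0 = - p * x $ 1" "(torus p q *v x) $ 1 = p * x $ 0"
  "(torus p q *v x) $ 2 = - q * x $ 3" "(torus p q *v x) $ 3 = q * x $ 2"
  "(torus p q *v x) $ 4 = - q * x $ 5" "(torus p q *v x) $ 5 = q * x $ 4"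
  "(torus p q *v x) $ 6 = - q * x $ 7" "(torus p q *v x) $ 7 = q * x $ 6"
  by (simp_all add: matrix_vector_mult_def torus_def sum_8)

lemma transpose_torus: "transpose (torus p q) = - torus p q"
  by (simp add: vec_eq_iff forall_8 transpose_def torus_def)

text \<open>The ratio is forced. At y = e0 the relation makes X0 send e2 to (p + q) e3; at e2 e4 =
  -e6 it then reads -q = (p + q) + q in the coordinate of e7, that is p = -3q.\<close>

lemma triality_algebra_torus: "triality_algebra (torus 0 (2 * r)) (torus (3 * r) (- r))"
proof -
  have "torus (3 * r) (- r) ** lmat x = lmat (torus 0 (2 * r) *v x) + lmat x ** torus (3 * r) (- r)" for x
  proof (rule matrix_eq_vectorI)
    fix y
    show "(torus (3 * r) (- r) ** lmat x) *v y = (lmat (torus 0 (2 * r) *v x) + lmat x ** torus (3 * r) (- r)) *v y"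
      unfolding matrix_vector_mult_add_rdistrib matrix_vector_mul_assoc[symmetric] lmat_mult vec_eq_8
        vector_add_component torus_mult cayley_mult_nth
      by (intro conjI; algebra)
  qed
  moreover have "torus 0 (2 * r) *v \<e> 0 = 0"
    by (simp add: vec_eq_8 torus_mult axis_def)
  ultimately show ?thesis
    by (simp add: triality_algebra_def transpose_torus)
qed

lemma torus_scale: "c *\<^sub>C torus p q = torus (c * p) (c * q)"
  by (simp add: cscale_def torus_def vec_eq_iff)

lemma torus_scaleR: "t *\<^sub>R torus p q = torus (of_real t * p) (of_real t * q)"
  unfolding vec_eq_iff vector_scaleR_component torus_def by (simp add: scaleR_conv_of_real)

abbreviation a0_gen :: "complex^8^8" where
  "a0_gen \<equiv> torus \<i> (- (\<i> / 3))"

lemma a0_tilde_eq: "a0_tilde = range (\<lambda>t. t *\<^sub>R a0_gen)"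
proof -
  have "block_diag (delta_mat t) (delta_mat (- t / 3)) (delta_mat (- t / 3)) (delta_mat (- t / 3)) =
      t *\<^sub>R a0_gen" for t
    unfolding torus_scaleR
    by (simp add: vec_eq_iff forall_8 torus_def block_diag_def block_pos_def delta_mat_def mult.commute)
  then show ?thesis by (auto simp: a0_tilde_def)
qed

lemma sign_matrix_mult: "(sign_matrix S *v x) $ i = (if i \<in> S then - x $ i else x $ i)"
  by (simp add: sign_matrix_def matrix_vector_mult_def if_distrib[of "\<lambda>x. x * _"] cong: if_cong)

lemma sign_matrix_conjugate:
  "(sign_matrix S ** Y ** transpose (sign_matrix S)) $ i $ j =
    (if i \<in> S then - 1 else 1) * (if j \<in> S then - 1 else 1) * Y $ i $ j"
proof -
  have l: "(sign_matrix S ** Z) $ i $ j = (if i \<in> S then - 1 else 1) * Z $ i $ j" for Z i j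
    by (simp add: matrix_mult_entry sign_matrix_def if_distrib[of "\<lambda>x. x * _"] cong: if_cong)
  have r: "(Z ** transpose (sign_matrix S)) $ i $ j = (if j \<in> S then - 1 else 1) * Z $ i $ j" for Z i j
    by (simp add: matrix_mult_entry sign_matrix_def transpose_def if_distrib[of "\<lambda>x. _ * x"] cong: if_cong)
  show ?thesis by (simp only: l r mult_ac)
qed

lemma cyclic_matrix_mult: "(cyclic_matrix *v x) $ i = x $ cyclic_perm i"
  by (simp add: cyclic_matrix_def matrix_vector_mult_def if_distrib[of "\<lambda>x. x * _"] cong: if_cong)

lemma cyclic_matrix_conjugate:
  "(cyclic_matrix ** Y ** transpose cyclic_matrix) $ i $ j = Y $ cyclic_perm i $ cyclic_perm j"
proof -
  have l: "(cyclic_matrix ** Z) $ i $ j = Z $ cyclic_perm i $ j" for Z i j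
    by (simp add: matrix_mult_entry cyclic_matrix_def if_distrib[of "\<lambda>x. x * _"] cong: if_cong)
  have r: "(Z ** transpose cyclic_matrix) $ i $ j = Z $ i $ cyclic_perm j" for Z i j
    by (simp add: matrix_mult_entry cyclic_matrix_def transpose_def if_distrib[of "\<lambda>x. _ * x"] cong: if_cong)
  show ?thesis by (simp only: l r)
qed

lemma G2C_I:
  assumes "transpose g ** g = mat 1" "det g = 1" "\<And>x y. (g *v x) \<star> (g *v y) = g *v (x \<star> y)"
  shows "g \<in> Spin7C"
  using assms G2C_iff[of g] by (simp add: G2C_def SO8C_iff)

text \<open>The unchanged coordinates span the quaternion subalgebras of e0, e1, e2, e3 and of e0,
  e1, e4, e5. Being 1 on such a subalgebra and -1 on its orthogonal complement is an
  automorphism.\<close>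

lemma sign_matrix_Spin7C:
  assumes "S = {4, 5, 6, 7} \<or> S = {2, 3, 6, 7}"
  shows "sign_matrix S \<in> Spin7C"
proof (rule G2C_I)
  have "(sign_matrix S ** mat 1 ** transpose (sign_matrix S)) $ i $ j = mat 1 $ i $ j" for i j
    unfolding sign_matrix_conjugate by (simp add: mat_def)
  then have "sign_matrix S ** transpose (sign_matrix S) = mat 1"
    by (simp add: vec_eq_iff)
  then show "transpose (sign_matrix S) ** sign_matrix S = mat 1"
    using matrix_left_right_inverse by blast
  have "det (sign_matrix S) = (\<Prod>i\<in>UNIV. if i \<in> S then - 1 else 1)"
    by (subst det_diagonal) (simp_all add: sign_matrix_def)
  also have "\<dots> = 1"
    using assms unfolding UNIV_8 by (elim disjE) simp_all
  finally show "det (sign_matrix S) = 1" .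
  show "(sign_matrix S *v x) \<star> (sign_matrix S *v y) = sign_matrix S *v (x \<star> y)" for x y
    using assms by (elim disjE) (simp_all add: vec_eq_8 sign_matrix_mult cayley_mult_nth)
qed

lemma cyclic_matrix_Spin7C: "cyclic_matrix \<in> Spin7C"
proof (rule G2C_I)
  have inj: "inj cyclic_perm"
    unfolding inj_def forall_8 by (simp add: cyclic_perm_def)
  then have "(cyclic_matrix ** mat 1 ** transpose cyclic_matrix) $ i $ j = mat 1 $ i $ j" for i j
    unfolding cyclic_matrix_conjugate by (simp add: mat_def inj_eq)
  then have "cyclic_matrix ** transpose cyclic_matrix = mat 1"
    by (simp add: vec_eq_iff)
  then show o: "transpose cyclic_matrix ** cyclic_matrix = mat 1"
    using matrix_left_right_inverse by blast
  \<comment> \<open>Order 3 gives det^3 = 1, orthogonality gives det^2 = 1, and together they give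
    det = 1.\<close>
  have "cyclic_matrix ** (cyclic_matrix ** cyclic_matrix) = mat 1"
    by (rule matrix_eq_vectorI)
       (simp add: vec_eq_8 cyclic_matrix_mult cyclic_perm_def flip: matrix_vector_mul_assoc)
  then have "det cyclic_matrix * (det cyclic_matrix * det cyclic_matrix) = 1"
    by (metis det_mul det_I)
  moreover have "det cyclic_matrix * det cyclic_matrix = 1"
    using o by (metis det_mul det_I det_transpose)
  ultimately show "det cyclic_matrix = 1" by simp
  show "(cyclic_matrix *v x) \<star> (cyclic_matrix *v y) = cyclic_matrix *v (x \<star> y)" for x y
    by (simp add: vec_eq_8 cyclic_matrix_mult cyclic_perm_def cayley_mult_nth)
qed

lemma torus_conjugate:
  "cyclic_matrix ** torus p q ** transpose cyclic_matrix = torus p q"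
  "S = {4, 5, 6, 7} \<or> S = {2, 3, 6, 7} \<Longrightarrow>
    sign_matrix S ** torus p q ** transpose (sign_matrix S) = torus p q"
proof -
  show "cyclic_matrix ** torus p q ** transpose cyclic_matrix = torus p q"
    unfolding vec_eq_iff cyclic_matrix_conjugate
    by (simp add: forall_8 torus_def cyclic_perm_def)
  show "sign_matrix S ** torus p q ** transpose (sign_matrix S) = torus p q"
    if "S = {4, 5, 6, 7} \<or> S = {2, 3, 6, 7}"
    using that unfolding vec_eq_iff sign_matrix_conjugate
    by (elim disjE) (simp_all add: forall_8 torus_def)
qed

text \<open>\<open>torus p q\<close> is fixed by a finite group of automorphisms generated by sign changes and a cyclic
  permutation of three coordinate planes. Averaging a derivation over the sign changes leaves rotations
  of these planes, by angles with sum zero; averaging over the permutation then gives zero.\<close>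
lemma torus_killing_orthogonal:
  assumes T: "torus p q \<in> lie_algebra Spin7C" and Y: "Y \<in> lie_algebra G2C"
  shows "killing_form (lie_algebra Spin7C) (torus p q) Y = 0"
proof -
  let ?L = "lie_algebra Spin7C"
  let ?K = "killing_form ?L (torus p q)"
  let ?c = "\<lambda>k Y. k ** Y ** transpose k"
  define S1 S2 :: "8 set" where S: "S1 = {4, 5, 6, 7}" "S2 = {2, 3, 6, 7}"
  \<comment> \<open>Unnormalized averages: the form against the torus element is multiplied by 2, 2
    and 3, which accounts for the factor 12 below.\<close>
  define Y1 where "Y1 = Y + ?c (sign_matrix S1) Y"
  define Y2 where "Y2 = Y1 + ?c (sign_matrix S2) Y1"
  define Y3 where "Y3 = Y2 + ?c cyclic_matrix Y2"
  define Y4 where "Y4 = Y3 + ?c cyclic_matrix (?c cyclic_matrix Y2)"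
  have add: "Z + Z' \<in> ?L" "?K (Z + Z') = ?K Z + ?K Z'" if "Z \<in> ?L" "Z' \<in> ?L" for Z Z'
    using cmat.subspace_add[OF subspace_lie_algebra_Spin7C that] killing_form_add_right[OF T that] by auto
  have conj: "?c k Z \<in> ?L" "?K (?c k Z) = ?K Z"
    if "k \<in> {sign_matrix S1, sign_matrix S2, cyclic_matrix}" "Z \<in> ?L" for k Z
  proof -
    have "sign_matrix S1 \<in> Spin7C" "?c (sign_matrix S1) (torus p q) = torus p q"
      "sign_matrix S2 \<in> Spin7C" "?c (sign_matrix S2) (torus p q) = torus p q"
      unfolding S by (intro sign_matrix_Spin7C torus_conjugate(2); blast)+
    then have k: "k \<in> Spin7C" "?c k (torus p q) = torus p q"
      using that(1) cyclic_matrix_Spin7C torus_conjugate(1) by blast+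
    show "?c k Z \<in> ?L" "?K (?c k Z) = ?K Z"
      using adjoint_Spin7C[OF that(2) k(1)] killing_form_adjoint[OF k(1) T that(2)] by (simp_all add: k(2))
  qed
  have YL: "Y \<in> ?L"
    using Y lie_algebra_mono[of G2C Spin7C] G2C_iff by blast
  then have L: "Y1 \<in> ?L" "Y2 \<in> ?L" "Y3 \<in> ?L" "Y4 \<in> ?L"
    unfolding Y1_def Y2_def Y3_def Y4_def by (auto intro!: add(1) conj(1))
  have "?K Y1 = 2 * ?K Y" "?K Y2 = 2 * ?K Y1" "?K Y4 = 3 * ?K Y2"
    unfolding Y4_def Y3_def using L YL
    by (simp_all add: Y1_def Y2_def add conj)
  then have K4: "?K Y4 = 12 * ?K Y" by simp
  have "?K Y4 = 0"
  proof -
    have skew: "transpose Y = - Y"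
      using YL by (auto simp: lie_algebra_Spin7C triality_algebra_def)
    have sk: "Y $ j $ i = - Y $ i $ j" for i j
      using arg_cong[OF skew, of "\<lambda>M. M $ i $ j"] by (simp add: transpose_def)
    have dg: "Y $ i $ i = 0" for i
      using sk[of i i] by simp
    have "Y *v \<e> 0 = 0"
      using lie_algebra_G2C_derivation[OF Y, of "\<e> 0" "\<e> 0"] by simp
    then have z: "Y $ i $ 0 = 0" for i
      unfolding matrix_entry_axis by simp
    \<comment> \<open>Since e2 e4 = -e6, the coordinate of e7 in the derivation rule says that the
      three rotation angles \<open>Y $ 3 $ 2\<close>, \<open>Y $ 5 $ 4\<close>,
      \<open>Y $ 7 $ 6\<close> add up to zero.\<close>
    have "(Y *v (\<e> 2 \<star> \<e> 4)) $ 7 = ((Y *v \<e> 2) \<star> \<e> 4 + \<e> 2 \<star> (Y *v \<e> 4)) $ 7"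
      using lie_algebra_G2C_derivation[OF Y] by metis
    moreover have "\<e> 2 \<star> \<e> 4 = - \<e> 6"
      by (simp add: vec_eq_8 cayley_mult_nth axis_def)
    moreover have ax: "\<e> k $ i = (if i = k then 1 else 0)" for k i
      by (simp add: axis_def)
    ultimately have "- Y $ 7 $ 6 = Y $ 3 $ 2 + Y $ 5 $ 4"
      by (simp add: cayley_mult_nth ax flip: matrix_entry_axis)
    then have sum0: "Y $ 7 $ 6 = - Y $ 3 $ 2 - Y $ 5 $ 4"
      by algebra
    have z': "Y $ 0 $ i = 0" for i
      using sk[of 0 i] z[of i] by simp
    note s = sk[of 2 3] sk[of 4 5] sk[of 6 7]
    define e1 e2 :: "8 \<Rightarrow> complex" where
      "e1 = (\<lambda>i. if i \<in> S1 then - 1 else 1)" "e2 = (\<lambda>i. if i \<in> S2 then - 1 else 1)"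
    have e: "e1 0 = 1" "e1 1 = 1" "e1 2 = 1" "e1 3 = 1" "e1 4 = - 1" "e1 5 = - 1" "e1 6 = - 1" "e1 7 = - 1"
      "e2 0 = 1" "e2 1 = 1" "e2 2 = - 1" "e2 3 = - 1" "e2 4 = 1" "e2 5 = 1" "e2 6 = - 1" "e2 7 = - 1"
      by (simp_all add: e1_e2_def S)
    have p: "cyclic_perm 0 = 0" "cyclic_perm 1 = 1" "cyclic_perm 2 = 6" "cyclic_perm 3 = 7"
      "cyclic_perm 4 = 2" "cyclic_perm 5 = 3" "cyclic_perm 6 = 4" "cyclic_perm 7 = 5"
      by (simp_all add: cyclic_perm_def)
    \<comment> \<open>The pair of signs differs from one coordinate plane to the next, so one of the
      two factors vanishes unless i and j lie in the same plane. In the plane of e0 and e1 nothing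
      remains because Y e0 = 0; in the other three only the angles survive.\<close>
    have Y2: "Y2 $ i $ j = (1 + e2 i * e2 j) * ((1 + e1 i * e1 j) * Y $ i $ j)" for i j
      by (simp add: Y2_def Y1_def sign_matrix_conjugate e1_e2_def)
    have "Y4 $ i $ j = Y2 $ i $ j + Y2 $ cyclic_perm i $ cyclic_perm j +
        Y2 $ cyclic_perm (cyclic_perm i) $ cyclic_perm (cyclic_perm j)" for i j
      by (simp add: Y4_def Y3_def cyclic_matrix_conjugate)
    then have "Y4 = 0"
      unfolding vec_eq_iff Y2 forall_8 by (simp add: p e z z' dg s sum0)
    \<comment> \<open>At Y4 = 0 additivity reads \<open>?K 0 = ?K 0 + ?K 0\<close>.\<close>
    then show ?thesis using add(2)[OF L(4) L(4)] by simp
  qed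
  with K4 show ?thesis by simp
qed

text \<open>The plane of e0 and e1 is stable and the generator squares to the identity there, which
  turns the rotation into a hyperbolic one; the stated curve solves the differential
  equation.\<close>

lemma mexp_a0_gen_axis:
  "mexp (t *\<^sub>R a0_gen) *v \<e> 0 = of_real (cosh t) *s \<e> 0 + (\<i> * of_real (sinh t)) *s \<e> 1"
proof -
  let ?F = "\<lambda>t. of_real (cosh t) *s \<e> 0 + (\<i> * of_real (sinh t)) *s \<e> 1 :: complex^8"
  have "(?F has_vector_derivative a0_gen *v ?F t) (at t)" for t
  proof (rule has_vector_derivative_vecI)
    fix i :: 8
    have c: "((\<lambda>t. complex_of_real (cosh t)) has_vector_derivative complex_of_real (sinh t)) (at t)"
      by (auto intro!: derivative_eq_intros has_vector_derivative_of_real simp: has_real_derivative_iff_has_vector_derivative[symmetric])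
    have s: "((\<lambda>t. \<i> * complex_of_real (sinh t)) has_vector_derivative \<i> * complex_of_real (cosh t)) (at t)"
      by (intro has_vector_derivative_mult_right has_vector_derivative_of_real)
         (auto intro!: derivative_eq_intros simp: has_real_derivative_iff_has_vector_derivative[symmetric])
    have "\<forall>i. ((\<lambda>t. ?F t $ i) has_vector_derivative (a0_gen *v ?F t) $ i) (at t)"
      unfolding forall_8 torus_mult using c s by (simp add: axis_def)
    then show "((\<lambda>t. ?F t $ i) has_vector_derivative (a0_gen *v ?F t) $ i) (at t)" ..
  qed
  from mexp_ode_vector_unique[of ?F, OF this, of t] show ?thesis by simp
qed

subsection \<open>Transitivity and the decomposition\<close>

definition complex_vec :: "real^8 \<Rightarrow> complex^8" where
  "complex_vec x = (\<chi> i. of_real (x $ i))"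

lemma complex_vec_real [simp]: "complex_vec x \<in> cayley_real"
  by (simp add: complex_vec_def cayley_real_def)

lemma cayley_real_complex_vec:
  assumes "x \<in> cayley_real"
  obtains y where "x = complex_vec y"
proof
  show "x = complex_vec (\<chi> i. Re (x $ i))"
    using assms by (simp add: complex_vec_def cayley_real_def vec_eq_iff)
qed

lemma dotc_complex_vec: "dotc (complex_vec x) (complex_vec y) = of_real (x \<bullet> y)"
  by (simp add: dotc_def complex_vec_def inner_vec_def)

lemma complex_vec_simps:
  "complex_vec (x + y) = complex_vec x + complex_vec y"
  "complex_vec (x - y) = complex_vec x - complex_vec y"
  "complex_vec (c *\<^sub>R x) = of_real c *s complex_vec x"
  by (simp_all add: complex_vec_def vec_eq_iff)

lemma exists_orthogonal_unit:
  fixes S :: "(real^8) set"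
  assumes "finite S" "card S < 8"
  shows "\<exists>w. w \<bullet> w = 1 \<and> (\<forall>v\<in>S. v \<bullet> w = 0)"
proof -
  have "dim S < DIM(real^8)"
    using dim_le_card'[OF assms(1)] assms(2) by simp
  then obtain y where y: "y \<noteq> 0" "\<And>x. x \<in> span S \<Longrightarrow> orthogonal y x"
    using orthogonal_to_subspace_exists by blast
  have "(y /\<^sub>R norm y) \<bullet> (y /\<^sub>R norm y) = 1"
    using y(1) by (simp add: dot_square_norm power2_eq_square)
  moreover have "v \<bullet> (y /\<^sub>R norm y) = 0" if "v \<in> S" for v
    using y(2)[OF span_base[OF that]] by (simp add: orthogonal_def inner_commute)
  ultimately show ?thesis by blast
qed

lemma exists_orthogonal_real:
  assumes "finite S" "card S < 8" "S \<subseteq> cayley_real"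
  shows "\<exists>w\<in>cayley_real. dotc w w = 1 \<and> (\<forall>v\<in>S. dotc v w = 0)"
proof -
  have "\<forall>v\<in>S. \<exists>x. v = complex_vec x"
    using assms(3) cayley_real_complex_vec by blast
  then obtain f where f: "\<forall>v\<in>S. v = complex_vec (f v)"
    by (rule bchoice[THEN exE])
  have "card (f ` S) < 8"
    using card_image_le[OF assms(1), of f] assms(2) by simp
  then obtain w where w: "w \<bullet> w = 1" "\<forall>v\<in>f ` S. v \<bullet> w = 0"
    using exists_orthogonal_unit[of "f ` S"] assms(1) by blast
  have "dotc v (complex_vec w) = 0" if "v \<in> S" for v
    using f that w(2) dotc_complex_vec[of "f v" w] by simp
  moreover have "dotc (complex_vec w) (complex_vec w) = 1"
    by (simp add: dotc_complex_vec w)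
  ultimately show ?thesis using complex_vec_real by blast
qed

lemma dotc_rmat_isometry:
  assumes "u $ 0 = 0" "dotc u u = 1"
  shows "dotc (x \<star> u) (y \<star> u) = dotc x y"
proof -
  have "dotc (rmat u *v x) (rmat u *v y) = dotc x (transpose (rmat u) *v (rmat u *v y))"
    by (rule dotc_matrix)
  then show ?thesis
    by (simp add: rmat_skew[OF assms(1)] imaginary_unit_mult_twice[OF assms] del: transpose_matrix_vector)
qed

text \<open>Left multiplication by u = a x^(-1) = -(ax) maps x to a. Orthogonality of a and x is
  exactly what makes u imaginary.\<close>

lemma Spin7_transitive_orthogonal:
  assumes x: "x $ 0 = 0" "dotc x x = 1" "x \<in> cayley_real"
    and a: "dotc a a = 1" "a \<in> cayley_real" "dotc a x = 0"
  shows "\<exists>k\<in>Spin7. k *v x = a"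
proof -
  let ?u = "- (a \<star> x)"
  have "?u $ 0 = 0"
    using cayley_mult_0(2)[OF x(1), of a] a(3) by simp
  moreover have "dotc ?u ?u = 1"
    using dotc_rmat_isometry[OF x(1,2), of a a] a(1) by (simp add: dotc_simps)
  moreover have "?u \<in> cayley_real"
    using x a by (intro cayley_real_simps)
  ultimately have "lmat ?u \<in> Spin7" by (rule lmat_Spin7)
  moreover have "lmat ?u *v x = a"
    by (simp add: cayley.minus_left imaginary_unit_mult_twice[OF x(1,2)])
  ultimately show ?thesis by blast
qed

text \<open>When a is not orthogonal to e0, no single left multiplication by an imaginary unit maps
  e0 to a; the route passes through a unit vector orthogonal to both.\<close>

lemma Spin7_transitive_sphere:
  assumes a: "dotc a a = 1" "a \<in> cayley_real"
  shows "\<exists>k\<in>Spin7. k *v \<e> 0 = a"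
proof -
  have "card {\<e> 0, a} < 8" by (simp add: card_insert_if)
  then obtain x where x: "x \<in> cayley_real" "dotc x x = 1" "\<forall>v\<in>{\<e> 0, a}. dotc v x = 0"
    using exists_orthogonal_real[of "{\<e> 0, a}"] a(2) cayley_real_simps(7) by blast
  have x0: "x $ 0 = 0" using x(3) by simp
  have "lmat x \<in> Spin7" using lmat_Spin7 x0 x by blast
  moreover obtain k where "k \<in> Spin7" "k *v x = a"
    using Spin7_transitive_orthogonal[OF x0 x(2,1) a] x(3) by blast
  ultimately show ?thesis
    by (intro bexI[of _ "k ** lmat x"]) (simp_all add: Spin7_mult flip: matrix_vector_mul_assoc)
qed

text \<open>For orthogonal imaginary units \<open>m\<close>, \<open>w\<close>, the element below is the identity on the quaternion
  subalgebra generated by \<open>m\<close> and \<open>w\<close>, and \<open>-1\<close> on its orthogonal complement.\<close>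
lemma quaternion_involution:
  assumes m: "m $ 0 = 0" "dotc m m = 1" and w: "w $ 0 = 0" "dotc w w = 1" "dotc m w = 0"
  defines "\<sigma> \<equiv> lmat (- (m \<star> w)) ** lmat m ** lmat w"
  shows "\<sigma> *v \<e> 0 = \<e> 0" "\<sigma> *v m = m"
    "d $ 0 = 0 \<Longrightarrow> dotc m d = 0 \<Longrightarrow> dotc w d = 0 \<Longrightarrow> dotc (m \<star> w) d = 0 \<Longrightarrow> \<sigma> *v d = - d"
    "(m \<star> w) $ 0 = 0" "dotc (m \<star> w) (m \<star> w) = 1"
proof -
  let ?c = "m \<star> w"
  show c0: "?c $ 0 = 0" using cayley_mult_0(1)[OF m(1), of w] w(3) by simp
  show c1: "dotc ?c ?c = 1" using dotc_rmat_isometry[OF w(1,2), of m m] m(2) by simp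
  have anti: "x \<star> y = - (y \<star> x)" if "x $ 0 = 0" "y $ 0 = 0" "dotc x y = 0" for x y
    using imaginary_anticommutator[OF that(1), of y] that(2,3) by (simp add: add_eq_0_iff)
  have \<sigma>: "\<sigma> *v x = - (?c \<star> (m \<star> (w \<star> x)))" for x
    by (simp add: \<sigma>_def cayley.minus_left flip: matrix_vector_mul_assoc)
  show "\<sigma> *v \<e> 0 = \<e> 0"
    by (simp add: \<sigma> imaginary_unit_square[OF c0 c1])
  have "m \<star> (w \<star> m) = w"
    using anti[OF w(1) m(1)] w(3)
    by (simp add: dotc_commute[of w m] cayley.minus_right imaginary_unit_mult_twice[OF m])
  then show "\<sigma> *v m = m"
    by (simp add: \<sigma> imaginary_unit_mult_twice[OF w(1,2)])
  assume d: "d $ 0 = 0" "dotc m d = 0" "dotc w d = 0" "dotc ?c d = 0"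
  \<comment> \<open>Anticommutation and linearized alternativity yield m(wd) = -(mw)d, the opposite
    of associativity, for d orthogonal to the quaternion subalgebra.\<close>
  have "m \<star> (w \<star> d) = - (m \<star> (d \<star> w))"
    using anti[OF w(1) d(1,3)] by (simp add: cayley.minus_right)
  also have "\<dots> = d \<star> ?c"
    using left_alternative_linear[of m d w] anti[OF m(1) d(1,2)]
    by (simp add: cayley.zero_left add_eq_0_iff)
  also have "\<dots> = - (?c \<star> d)"
    using anti[OF c0 d(1,4)] by simp
  finally show "\<sigma> *v d = - d"
    by (simp add: \<sigma> cayley.minus_right imaginary_unit_mult_twice[OF c0 c1])
qed

text \<open>The vectors p + b and p - b are orthogonal. A quaternion involution whose subalgebra
  contains p + b and is orthogonal to p - b fixes the sum and negates the difference, hence maps p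
  to b.\<close>

lemma Spin7_transitive_stabilizer:
  assumes p: "p $ 0 = 0" "dotc p p = 1" "p \<in> cayley_real"
    and b: "b $ 0 = 0" "dotc b b = 1" "b \<in> cayley_real"
  shows "\<exists>k\<in>Spin7. k *v \<e> 0 = \<e> 0 \<and> k *v p = b"
proof -
  let ?d = "p - b"
  have dr: "?d \<in> cayley_real" using p b by (intro cayley_real_simps)
  have "\<exists>m r. m \<in> cayley_real \<and> m $ 0 = 0 \<and> dotc m m = 1 \<and> dotc m ?d = 0 \<and> p + b = r *s m"
  \<comment> \<open>The vector m normalizes p + b. If b = -p there is no such direction, and any
    imaginary unit orthogonal to p - b serves, with r = 0.\<close>
  proof (cases "p + b = 0")
    case True
    have "card {\<e> 0, ?d} < 8" by (simp add: card_insert_if)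
    then obtain m where m: "m \<in> cayley_real" "dotc m m = 1" "\<forall>v\<in>{\<e> 0, ?d}. dotc v m = 0"
      using exists_orthogonal_real[of "{\<e> 0, ?d}"] dr cayley_real_simps(7) by blast
    then show ?thesis
      using True by (intro exI[of _ m] exI[of _ 0]) (auto simp: dotc_commute)
  next
    case False
    obtain s where s: "p + b = complex_vec s"
      using cayley_real_complex_vec cayley_real_simps(1)[OF p(3) b(3)] by blast
    have n: "norm s \<noteq> 0"
      using False s by (auto simp: complex_vec_def vec_eq_iff)
    define m where "m = of_real (1 / norm s) *s (p + b)"
    have "dotc (p + b) (p + b) = of_real (norm s * norm s)"
      unfolding s dotc_complex_vec by (simp add: dot_square_norm power2_eq_square)
    then have "dotc m m = 1"
      using n unfolding m_def dotc_simps(7,8) by (simp add: field_simps)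
    moreover have "dotc (p + b) ?d = 0"
      by (simp add: dotc_simps p b dotc_commute[of p b])
    then have "dotc m ?d = 0"
      unfolding m_def dotc_simps(7) by simp
    moreover have "m \<in> cayley_real" "m $ 0 = 0"
      unfolding m_def by (auto simp: p b intro!: cayley_real_simps)
    moreover have "p + b = of_real (norm s) *s m"
      using n unfolding m_def vector_smult_assoc by simp
    ultimately show ?thesis by blast
  qed
  then obtain m r where m: "m \<in> cayley_real" "m $ 0 = 0" "dotc m m = 1" "dotc m ?d = 0" "p + b = r *s m"
    by blast
  \<comment> \<open>Orthogonality of w to m(p - b) encodes that of mw to p - b, since left
    multiplication by m is skew.\<close>
  have "card {\<e> 0, m, ?d, m \<star> ?d} < 8" by (simp add: card_insert_if)
  then obtain w where w: "w \<in> cayley_real" "dotc w w = 1"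
      "\<forall>v\<in>{\<e> 0, m, ?d, m \<star> ?d}. dotc v w = 0"
    using exists_orthogonal_real[of "{\<e> 0, m, ?d, m \<star> ?d}"] dr m(1) cayley_real_simps(4,7) by blast
  have w0: "w $ 0 = 0" "dotc m w = 0" "dotc w ?d = 0"
    using w(3) dotc_commute[of w ?d] by simp_all
  have wd: "dotc (m \<star> w) ?d = 0"
    using dotc_lmat_skew[OF m(2), of w ?d] dotc_commute[of w "m \<star> ?d"] w(3) by simp
  define \<sigma> where "\<sigma> = lmat (- (m \<star> w)) ** lmat m ** lmat w"
  note q = quaternion_involution[OF m(2,3) w0(1) w(2) w0(2), folded \<sigma>_def]
  have "\<sigma> \<in> Spin7"
    unfolding \<sigma>_def using m w w0 q(4,5)
    by (intro Spin7_mult lmat_Spin7 cayley_real_simps) (simp_all add: dotc_simps)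
  moreover have "\<sigma> *v p = b"
  proof -
    have "\<sigma> *v ?d = - ?d"
      using q(3)[of ?d] p b m(4) w0(3) wd by simp
    moreover have "\<sigma> *v (p + b) = p + b"
      unfolding m(5) by (simp add: vector_scalar_commute q(2))
    ultimately have "\<sigma> *v ?d + \<sigma> *v (p + b) = b + b" by simp
    then have "\<sigma> *v p + \<sigma> *v p = b + b"
      by (simp add: matrix_vector_right_distrib matrix_vector_mult_diff_distrib)
    then show ?thesis by (simp add: vec_eq_iff)
  qed
  ultimately show ?thesis using q(1) by blast
qed

text \<open>Once some k carries e0 to a, pulling b back by k gives a vector orthogonal to e0, hence
  an imaginary one, within reach of the stabilizer of e0.\<close>

lemma Spin7_transitive_pairs:
  assumes a: "dotc a a = 1" "a \<in> cayley_real" and b: "dotc b b = 1" "b \<in> cayley_real" "dotc a b = 0"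
  shows "\<exists>k\<in>Spin7. k *v \<e> 0 = a \<and> k *v \<e> 1 = b"
proof -
  obtain k where k: "k \<in> Spin7" "k *v \<e> 0 = a"
    using Spin7_transitive_sphere[OF a] by blast
  have kS: "k \<in> SO8C" "transpose k \<in> SO8C" and kr: "real_matrix (transpose k)"
    using k(1) Spin7_transpose by (auto simp: Spin7_iff Spin7C_SO8C SO8C_transpose real_matrix_transpose)
  let ?b = "transpose k *v b"
  have "dotc (\<e> 0) ?b = 0"
    using dotc_matrix[of k "\<e> 0" b] k(2) b(3) by simp
  then have "?b $ 0 = 0" by simp
  moreover have "dotc ?b ?b = 1"
    using dotc_orthogonal[OF SO8C_inverse(1)[OF kS(2)]] b(1) by simp
  moreover have "?b \<in> cayley_real" using cayley_real_simps(6)[OF kr b(2)] .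
  moreover have "\<e> 1 $ 0 = (0::complex)" "dotc (\<e> 1) (\<e> 1) = 1"
    by (simp_all add: axis_def dotc_def sum_8)
  ultimately obtain l where l: "l \<in> Spin7" "l *v \<e> 0 = \<e> 0" "l *v \<e> 1 = ?b"
    using Spin7_transitive_stabilizer[of "\<e> 1" ?b] cayley_real_simps(7) by blast
  show ?thesis
  proof (intro bexI conjI)
    show "k ** l \<in> Spin7" using k l by (intro Spin7_mult)
    show "(k ** l) *v \<e> 0 = a"
      by (simp add: l k flip: matrix_vector_mul_assoc)
    show "(k ** l) *v \<e> 1 = b"
      by (simp only: l matrix_vector_mul_assoc[symmetric] SO8C_cancel(2)[OF kS(1)])
  qed
qed

lemma a0_gen_Spin7C: "mexp (t *\<^sub>R a0_gen) \<in> Spin7C"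
  using triality_algebra_torus[of "\<i> / 3"] triality_algebra_mexp by force

lemma Spin7C_unit_orbit:
  assumes g: "g \<in> Spin7C"
  shows "\<exists>k\<in>Spin7. \<exists>t. k *v (mexp (t *\<^sub>R a0_gen) *v \<e> 0) = g *v \<e> 0"
proof -
  obtain a b where ab: "a \<in> cayley_real" "b \<in> cayley_real" "g *v \<e> 0 = a + \<i> *s b"
    by (rule cayley_real_decomp)
  obtain x y where xy: "a = complex_vec x" "b = complex_vec y"
    using ab cayley_real_complex_vec by metis
  have "dotc (g *v \<e> 0) (g *v \<e> 0) = 1"
    unfolding dotc_orthogonal[OF SO8C_inverse(1)[OF Spin7C_SO8C[OF g]]] dotc_axis_0 by (simp add: axis_def)
  then have "of_real (x \<bullet> x - y \<bullet> y) + \<i> * of_real (2 * (x \<bullet> y)) = (1 :: complex)"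
    unfolding ab(3) xy by (simp add: dotc_simps dotc_complex_vec inner_commute[of y x] algebra_simps)
  then have eq: "x \<bullet> x - y \<bullet> y = 1" "x \<bullet> y = 0"
    by (simp_all add: complex_eq_iff)
  \<comment> \<open>The parameter is read off from the imaginary part; cosh t is then the norm of
    the real part, because the squared norms differ by 1.\<close>
  define t where "t = arsinh (norm y)"
  have s: "sinh t = norm y" by (simp add: t_def)
  have "(cosh t)\<^sup>2 = (norm x)\<^sup>2"
    using eq(1) cosh_square_eq[of t] by (simp add: s dot_square_norm)
  then have c: "cosh t = norm x"
    using power2_eq_iff_nonneg[of "cosh t" "norm x"] cosh_real_nonneg by simp
  have nx: "norm x \<noteq> 0" using cosh_real_pos[of t] c by simp
  define x' where "x' = x /\<^sub>R norm x"
  \<comment> \<open>The real part has norm cosh t > 0, but the imaginary part may vanish; its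
    direction is then any unit vector orthogonal to x'.\<close>
  have "\<exists>y'. y' \<bullet> y' = 1 \<and> x' \<bullet> y' = 0 \<and> y = norm y *\<^sub>R y'"
  proof (cases "y = 0")
    case True
    obtain w where "w \<bullet> w = 1" "\<forall>v\<in>{x'}. v \<bullet> w = 0"
      using exists_orthogonal_unit[of "{x'}"] by auto
    with True show ?thesis by auto
  next
    case False
    then show ?thesis
      using eq(2) by (intro exI[of _ "y /\<^sub>R norm y"]) (simp add: x'_def dot_square_norm power2_eq_square)
  qed
  then obtain y' where y': "y' \<bullet> y' = 1" "x' \<bullet> y' = 0" "y = norm y *\<^sub>R y'" by blast
  have x': "x' \<bullet> x' = 1" "x = norm x *\<^sub>R x'"
    using nx by (simp_all add: x'_def dot_square_norm power2_eq_square)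
  obtain k where k: "k \<in> Spin7" "k *v \<e> 0 = complex_vec x'" "k *v \<e> 1 = complex_vec y'"
    using Spin7_transitive_pairs[of "complex_vec x'" "complex_vec y'"] x' y' by (auto simp: dotc_complex_vec)
  have "k *v (mexp (t *\<^sub>R a0_gen) *v \<e> 0) =
      of_real (norm x) *s complex_vec x' + (\<i> * of_real (norm y)) *s complex_vec y'"
    by (simp add: mexp_a0_gen_axis matrix_vector_right_distrib vector_scalar_commute k c s)
  also have "\<dots> = complex_vec (norm x *\<^sub>R x') + \<i> *s complex_vec (norm y *\<^sub>R y')"
    by (simp only: complex_vec_simps vector_smult_assoc)
  also have "\<dots> = g *v \<e> 0"
    using x'(2) y'(3) by (simp add: ab(3) xy)
  finally show ?thesis using k(1) by blast
qed

lemma Spin7C_decomposition: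
  "Spin7C = {g ** a ** h | g a h. g \<in> Spin7 \<and> a \<in> A0_tilde \<and> h \<in> G2C}"
proof (intro subset_antisym subsetI)
  fix g assume g: "g \<in> Spin7C"
  obtain k t where k: "k \<in> Spin7" and e: "k *v (mexp (t *\<^sub>R a0_gen) *v \<e> 0) = g *v \<e> 0"
    using Spin7C_unit_orbit[OF g] by blast
  define l where "l = k ** mexp (t *\<^sub>R a0_gen)"
  have l: "l \<in> Spin7C"
    unfolding l_def using k by (intro Spin7C_mult a0_gen_Spin7C) (simp add: Spin7_iff)
  have lS: "l \<in> SO8C" using Spin7C_SO8C[OF l] .
  have le: "l *v \<e> 0 = g *v \<e> 0"
    using e by (simp add: l_def matrix_vector_mul_assoc)
  have "transpose l ** g \<in> G2C"
    unfolding G2C_iff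
    by (simp only: Spin7C_mult Spin7C_transpose l g matrix_vector_mul_assoc[symmetric] le[symmetric] SO8C_cancel(1)[OF lS])
  moreover have "g = l ** (transpose l ** g)"
    by (simp only: matrix_mul_assoc SO8C_inverse(2)[OF lS] matrix_mul_lid)
  moreover have "mexp (t *\<^sub>R a0_gen) \<in> A0_tilde"
    by (auto simp: A0_tilde_def a0_tilde_eq)
  ultimately show "g \<in> {g ** a ** h | g a h. g \<in> Spin7 \<and> a \<in> A0_tilde \<and> h \<in> G2C}"
    using k unfolding l_def by blast
next
  fix g assume "g \<in> {g ** a ** h | g a h. g \<in> Spin7 \<and> a \<in> A0_tilde \<and> h \<in> G2C}"
  then obtain k t h where "g = k ** mexp (t *\<^sub>R a0_gen) ** h" "k \<in> Spin7" "h \<in> G2C"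
    unfolding A0_tilde_def a0_tilde_eq by blast
  then show "g \<in> Spin7C"
    using a0_gen_Spin7C[of t] by (simp only: Spin7_iff G2C_iff Spin7C_mult)
qed

section \<open>\<open>A0_tilde\<close> as a one-dimensional abelian group\<close>

lemma A0_tilde_eq: "A0_tilde = range (\<lambda>t. mexp (t *\<^sub>R a0_gen))"
  by (auto simp: A0_tilde_def a0_tilde_eq)

lemma comm_group_A0_tilde: "comm_group (matrix_group A0_tilde)"
proof (rule comm_groupI)
  show "x \<otimes>\<^bsub>matrix_group A0_tilde\<^esub> y \<in> carrier (matrix_group A0_tilde)"
    if "x \<in> carrier (matrix_group A0_tilde)" "y \<in> carrier (matrix_group A0_tilde)" for x y
    using that by (auto simp: matrix_group_def A0_tilde_eq mexp_add[symmetric])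
  show "\<one>\<^bsub>matrix_group A0_tilde\<^esub> \<in> carrier (matrix_group A0_tilde)"
    by (auto simp: matrix_group_def A0_tilde_eq intro!: image_eqI[of _ _ 0])
  show "x \<otimes>\<^bsub>matrix_group A0_tilde\<^esub> y = y \<otimes>\<^bsub>matrix_group A0_tilde\<^esub> x"
    if "x \<in> carrier (matrix_group A0_tilde)" "y \<in> carrier (matrix_group A0_tilde)" for x y
    using that by (auto simp: matrix_group_def A0_tilde_eq mexp_add[symmetric] add.commute)
  show "\<exists>y\<in>carrier (matrix_group A0_tilde). y \<otimes>\<^bsub>matrix_group A0_tilde\<^esub> x = \<one>\<^bsub>matrix_group A0_tilde\<^esub>"
    if "x \<in> carrier (matrix_group A0_tilde)" for x
  proof -
    have "x \<in> A0_tilde" using that by (simp add: matrix_group_def)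
    then obtain t where "x = mexp (t *\<^sub>R a0_gen)" unfolding A0_tilde_eq by blast
    then show ?thesis
      using mexp_inverse(1)[of t a0_gen] unfolding matrix_group_def A0_tilde_eq by (simp, metis)
  qed
qed (auto simp: matrix_group_def matrix_mul_assoc)

text \<open>Through arsinh this entry recovers t smoothly from the matrix.\<close>

lemma mexp_a0_gen_entry: "mexp (t *\<^sub>R a0_gen) $ 1 $ 0 = \<i> * of_real (sinh t)"
  unfolding matrix_entry_axis mexp_a0_gen_axis by (simp add: axis_def)

text \<open>A one-parameter group inside \<open>A0_tilde\<close> has the form exp(f(t)
  \<open>a0_gen\<close>) with f a priori arbitrary. Expressing f by arsinh of a matrix entry makes
  it differentiable at 0, and then X = f'(0) \<open>a0_gen\<close>.\<close>

lemma lie_algebra_A0_tilde: "lie_algebra A0_tilde = a0_tilde"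
proof (intro subset_antisym subsetI)
  fix X assume "X \<in> lie_algebra A0_tilde"
  then have "\<exists>s. mexp (t *\<^sub>R X) = mexp (s *\<^sub>R a0_gen)" for t
    by (auto simp: lie_algebra_def A0_tilde_eq)
  then obtain f where f: "\<And>t. mexp (t *\<^sub>R X) = mexp (f t *\<^sub>R a0_gen)"
    by metis
  have f_eq: "f t = arsinh (Im (mexp (t *\<^sub>R X) $ 1 $ 0))" for t
    unfolding f mexp_a0_gen_entry by (simp add: arsinh_sinh_real)
  have "bounded_linear (\<lambda>M :: complex^8^8. Im (M $ 1 $ 0))"
    by (intro bounded_linear_compose[OF bounded_linear_Im] bounded_linear_compose[OF bounded_linear_vec_nth] bounded_linear_vec_nth)
  from bounded_linear.has_vector_derivative[OF this mexp_deriv_0[of X]]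
  have "((\<lambda>t. Im (mexp (t *\<^sub>R X) $ 1 $ 0)) has_real_derivative Im (X $ 1 $ 0)) (at 0)"
    by (simp add: has_real_derivative_iff_has_vector_derivative)
  then obtain D where "((\<lambda>t. arsinh (Im (mexp (t *\<^sub>R X) $ 1 $ 0))) has_real_derivative D) (at 0)"
    using DERIV_chain2[OF arsinh_real_has_field_derivative] by blast
  moreover have "f = (\<lambda>t. arsinh (Im (mexp (t *\<^sub>R X) $ 1 $ 0)))"
    using f_eq by (rule ext)
  ultimately have D: "(f has_real_derivative D) (at 0)" by (simp only:)
  have f0: "f 0 = 0" unfolding f_eq by (simp add: mat_def)
  have "((\<lambda>t. mexp (f t *\<^sub>R a0_gen)) has_vector_derivative D *\<^sub>R a0_gen) (at 0)"
    using vector_diff_chain_at[OF D[unfolded has_real_derivative_iff_has_vector_derivative], of "\<lambda>t. mexp (t *\<^sub>R a0_gen)" a0_gen]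
      mexp_deriv_0[of a0_gen] by (simp add: f0 o_def)
  then have "X = D *\<^sub>R a0_gen"
    using mexp_deriv_0[of X] unfolding f by (rule vector_derivative_unique_at[rotated])
  then show "X \<in> a0_tilde" by (auto simp: a0_tilde_eq)
next
  fix X assume "X \<in> a0_tilde"
  then show "X \<in> lie_algebra A0_tilde"
    by (auto simp: lie_algebra_def A0_tilde_eq a0_tilde_eq)
qed

text \<open>The dimension of the group is understood as the real dimension of its Lie algebra, the
  real line through \<open>a0_gen\<close>.\<close>

lemma dim_lie_algebra_A0_tilde: "dim (lie_algebra A0_tilde) = 1"
proof -
  have "a0_gen \<noteq> 0" 
    by (simp add: vec_eq_iff forall_8 torus_def)
  then show ?thesis
    unfolding lie_algebra_A0_tilde a0_tilde_eq span_singleton[symmetric] dim_span by simp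
qed

lemma a0_tilde_lie_algebra_Spin7: "a0_tilde \<subseteq> (\<lambda>X. \<i> *\<^sub>C X) ` lie_algebra Spin7"
proof
  fix X assume "X \<in> a0_tilde"
  then obtain t where X: "X = t *\<^sub>R a0_gen" by (auto simp: a0_tilde_eq)
  \<comment> \<open>Dividing by the imaginary unit makes the generator a real matrix, so its
    exponentials are real.\<close>
  let ?Z = "torus (of_real t) (- of_real t / 3)"
  have "mexp (s *\<^sub>R ?Z) \<in> Spin7" for s
    unfolding Spin7_iff
  proof
    show "mexp (s *\<^sub>R ?Z) \<in> Spin7C"
      using triality_algebra_mexp[OF triality_algebra_torus[of "of_real t / 3"]] by simp
    show "real_matrix (mexp (s *\<^sub>R ?Z))"
      unfolding torus_scaleR by (intro allI mexp_real_entries) (auto simp: torus_def)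
  qed
  then have "?Z \<in> lie_algebra Spin7" by (simp add: lie_algebra_def)
  moreover have "X = \<i> *\<^sub>C ?Z"
    unfolding X torus_scaleR torus_scale by (simp add: mult.commute)
  ultimately show "X \<in> (\<lambda>X. \<i> *\<^sub>C X) ` lie_algebra Spin7" by blast
qed

lemma a0_tilde_killing_orthogonal:
  "a0_tilde \<subseteq> killing_orthogonal (lie_algebra Spin7C) (lie_algebra G2C)"
proof
  fix X assume "X \<in> a0_tilde"
  then obtain t where X: "X = torus (of_real t * \<i>) (of_real t * (- (\<i> / 3)))"
    by (auto simp: a0_tilde_eq torus_scaleR)
  have "X \<in> lie_algebra Spin7C"
    unfolding X lie_algebra_Spin7C using triality_algebra_torus[of "of_real t * \<i> / 3"] by (auto simp: field_simps)
  then show "X \<in> killing_orthogonal (lie_algebra Spin7C) (lie_algebra G2C)"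
    unfolding killing_orthogonal_def X using torus_killing_orthogonal by blast
qed

theorem theorem4p6:
  "a0_tilde \<subseteq> (\<lambda>X. \<i> *\<^sub>C X) ` lie_algebra Spin7 \<inter>
      killing_orthogonal (lie_algebra Spin7C) (lie_algebra G2C) \<and>
   comm_group (matrix_group A0_tilde) \<and>
   dim (lie_algebra A0_tilde) = 1 \<and>
   Spin7C = {g ** a ** h | g a h. g \<in> Spin7 \<and> a \<in> A0_tilde \<and> h \<in> G2C}"
  using a0_tilde_lie_algebra_Spin7 a0_tilde_killing_orthogonal comm_group_A0_tilde
    dim_lie_algebra_A0_tilde Spin7C_decomposition by blast

end
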